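(* For $1\le i\le s$ let ${\mathcal B}_i$ be a finite $w_{\mathfrak P_i}$-reduced family of nonzero elements of $L$, and let $z_i\in L^*$ be such that for every $b\in{\mathcal B}_i$: (1) $\lfloor w_{\mathfrak P_i}(z_ib)\rfloor\le\lfloor w_{\mathfrak P_j}(z_ib)\rfloor$ for all $j$ with $i<j\le s$; (2) $\lfloor w_{\mathfrak P_i}(z_ib)\rfloor<\lfloor w_{\mathfrak P_l}(z_ib)\rfloor$ for all $l$ with $1\le l<i$. Then the family $\bigcup_{i=1}^s z_i{\mathcal B}_i$ is $w_S$-semi-reduced.
   Context: Let $A$ be a Dedekind domain with fraction field $K$, $\mathfrak p$ a nonzero prime ideal with valuation $v_\mathfrak p$. Let $f\in A[x]$ be monic irreducible separable, $\theta$ a root, $L=K(\theta)$, $\mathcal O$ the integral closure of $A$ in $L$, and $S=\{\mathfrak P_1,\dots,\mathfrak P_s\}$ the set of all primes of $\mathcal O$ over $\mathfrak p$ (in a fixed order), with ramification indices $e_i$ and normalized valuations $v_{\mathfrak P_i}$; $w_{\mathfrak P_i}=v_{\mathfrak P_i}/e_i$, $w_S(z)=\min_iw_{\mathfrak P_i}(z)$. A finite family ${\mathcal B}\subset L$ is $w$-reduced if $w(\sum_b\lambda_bb)=\min_bw(\lambda_bb)$ for all $\lambda_b\in K$, and $w$-semi-reduced if $\lfloor w(\sum_b\lambda_bb)\rfloor=\min_b\lfloor w(\lambda_bb)\rfloor$ for all $\lambda_b\in K$. *)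

theory Defs
  imports "HOL-Library.Extended_Real" "HOL-Computational_Algebra.Polynomial"
begin

text \<open>All rings and fields live as subsets of one ambient field of type 'a.\<close>

definition subring_of :: "'a::field set \<Rightarrow> bool" where
  "subring_of R \<longleftrightarrow> 0 \<in> R \<and> 1 \<in> R \<and> (\<forall>x\<in>R. \<forall>y\<in>R. x + y \<in> R \<and> x - y \<in> R \<and> x * y \<in> R)"

definition ideal_of :: "'a::field set \<Rightarrow> 'a set \<Rightarrow> bool" where
  "ideal_of R I \<longleftrightarrow> I \<subseteq> R \<and> 0 \<in> I \<and> (\<forall>x\<in>I. \<forall>y\<in>I. x + y \<in> I)
     \<and> (\<forall>r\<in>R. \<forall>x\<in>I. r * x \<in> I)"

definition prime_ideal_of :: "'a::field set \<Rightarrow> 'a set \<Rightarrow> bool" where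
  "prime_ideal_of R P \<longleftrightarrow> ideal_of R P \<and> P \<noteq> R
     \<and> (\<forall>a\<in>R. \<forall>b\<in>R. a * b \<in> P \<longrightarrow> a \<in> P \<or> b \<in> P)"

definition ideal_gen :: "'a::field set \<Rightarrow> 'a set \<Rightarrow> 'a set" where
  "ideal_gen R F = {\<Sum>x\<in>F. r x * x | r. \<forall>x\<in>F. r x \<in> R}"

definition frac_field :: "'a::field set \<Rightarrow> 'a set" where
  "frac_field A = {a / b | a b. a \<in> A \<and> b \<in> A \<and> b \<noteq> 0}"

definition integral_over :: "'a::field set \<Rightarrow> 'a \<Rightarrow> bool" where
  "integral_over A x \<longleftrightarrow> (\<exists>g. lead_coeff g = 1 \<and> (\<forall>i. coeff g i \<in> A) \<and> poly g x = 0)"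

definition dedekind_domain :: "'a::field set \<Rightarrow> bool" where
  "dedekind_domain A \<longleftrightarrow> subring_of A
     \<and> (\<forall>I. ideal_of A I \<longrightarrow> (\<exists>F. finite F \<and> F \<subseteq> I \<and> I = ideal_gen A F))
     \<and> (\<forall>x\<in>frac_field A. integral_over A x \<longrightarrow> x \<in> A)
     \<and> (\<forall>P. prime_ideal_of A P \<and> P \<noteq> {0} \<longrightarrow>
            (\<forall>J. ideal_of A J \<and> P \<subseteq> J \<longrightarrow> J = P \<or> J = A))"

definition irreducible_over :: "'a::field set \<Rightarrow> 'a poly \<Rightarrow> bool" where
  "irreducible_over K f \<longleftrightarrow> degree f > 0 \<and>
     (\<forall>g h. (\<forall>i. coeff g i \<in> K) \<and> (\<forall>i. coeff h i \<in> K) \<and> f = g * h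
        \<longrightarrow> degree g = 0 \<or> degree h = 0)"

definition separable_over :: "'a::field set \<Rightarrow> 'a poly \<Rightarrow> bool" where
  "separable_over K f \<longleftrightarrow> (\<exists>u v. (\<forall>i. coeff u i \<in> K) \<and> (\<forall>i. coeff v i \<in> K)
     \<and> u * f + v * pderiv f = 1)"

definition simple_ext :: "'a::field set \<Rightarrow> 'a \<Rightarrow> 'a set" where
  "simple_ext K \<theta> = {poly g \<theta> / poly h \<theta> | g h. (\<forall>i. coeff g i \<in> K) \<and> (\<forall>i. coeff h i \<in> K)
     \<and> poly h \<theta> \<noteq> 0}"

definition int_closure :: "'a::field set \<Rightarrow> 'a set \<Rightarrow> 'a set" where
  "int_closure A L = {x \<in> L. integral_over A x}"

definition primes_over :: "'a::field set \<Rightarrow> 'a set \<Rightarrow> 'a set \<Rightarrow> 'a set set" where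
  "primes_over Ocl A p = {P. prime_ideal_of Ocl P \<and> P \<noteq> {0} \<and> P \<inter> A = p}"

definition ideal_mult :: "'a::field set \<Rightarrow> 'a set \<Rightarrow> 'a set" where
  "ideal_mult I J = {\<Sum>k<n. a k * b k | (n::nat) a b. \<forall>k<n. a k \<in> I \<and> b k \<in> J}"

fun ideal_pow :: "'a::field set \<Rightarrow> 'a set \<Rightarrow> nat \<Rightarrow> 'a set" where
  "ideal_pow Ocl P 0 = Ocl"
| "ideal_pow Ocl P (Suc n) = ideal_mult (ideal_pow Ocl P n) P"

definition val_O :: "'a::field set \<Rightarrow> 'a set \<Rightarrow> 'a \<Rightarrow> nat" where
  "val_O Ocl P x = (GREATEST n. x \<in> ideal_pow Ocl P n)"

definition val_L :: "'a::field set \<Rightarrow> 'a set \<Rightarrow> 'a \<Rightarrow> int" where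
  "val_L Ocl P x = (THE k. \<exists>a\<in>Ocl. \<exists>b\<in>Ocl. a \<noteq> 0 \<and> b \<noteq> 0 \<and> x = a / b
                     \<and> k = int (val_O Ocl P a) - int (val_O Ocl P b))"

text \<open>Ramification index: pO = prod Q^(e_Q), so e_P is the largest n with p contained in P^n.\<close>
definition ram_index :: "'a::field set \<Rightarrow> 'a set \<Rightarrow> 'a set \<Rightarrow> nat" where
  "ram_index Ocl p P = (GREATEST n. p \<subseteq> ideal_pow Ocl P n)"

definition wP :: "'a::field set \<Rightarrow> 'a set \<Rightarrow> 'a set \<Rightarrow> 'a \<Rightarrow> ereal" where
  "wP Ocl p P x = (if x = 0 then \<infinity>
      else ereal (real_of_int (val_L Ocl P x) / real (ram_index Ocl p P)))"

definition wS :: "'a::field set \<Rightarrow> 'a set \<Rightarrow> 'a set list \<Rightarrow> 'a \<Rightarrow> ereal" where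
  "wS Ocl p Ps x = (INF P\<in>set Ps. wP Ocl p P x)"

definition efloor :: "ereal \<Rightarrow> ereal" where
  "efloor x = (case x of ereal r \<Rightarrow> ereal (of_int \<lfloor>r\<rfloor>) | PInfty \<Rightarrow> PInfty | MInfty \<Rightarrow> MInfty)"

definition w_reduced :: "'a::field set \<Rightarrow> ('a \<Rightarrow> ereal) \<Rightarrow> 'a set \<Rightarrow> bool" where
  "w_reduced K w C \<longleftrightarrow> (\<forall>lam. (\<forall>c\<in>C. lam c \<in> K) \<longrightarrow>
      w (\<Sum>c\<in>C. lam c * c) = (INF c\<in>C. w (lam c * c)))"

definition w_semi_reduced :: "'a::field set \<Rightarrow> ('a \<Rightarrow> ereal) \<Rightarrow> 'a set \<Rightarrow> bool" where
  "w_semi_reduced K w C \<longleftrightarrow> (\<forall>lam. (\<forall>c\<in>C. lam c \<in> K) \<longrightarrow>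
      efloor (w (\<Sum>c\<in>C. lam c * c)) = (INF c\<in>C. efloor (w (lam c * c))))"

end

(* Every a in A becomes a unit at p after multiplication by a power of a fraction u, the
   inverse of a uniformizer.  For a prime P of the integral closure over p, each z in L
   satisfies a relation of bounded degree with coefficients in A, not all in p; its Horner
   sums are integral and show that z or its inverse lies in the local ring at P, and its
   bounded degree forces that valuation ring to be discrete.  So the functions w_P are
   valuations, and on K they take integer values that do not depend on P.  Hence, for c in
   z_i B_i, scaling by K preserves the floor conditions.

   Let m be the minimum of the floors of w_S over the terms of a linear combination and let j be
   the least index for which a term from z_j B_j attains m.  At P_j all terms outside z_j B_j have
   value at least m + 1: earlier ones since they do not attain m, later ones by the
   strict inequality (2).  The part in z_j B_j has value less than m + 1 by reducedness, so it
   determines the floor of the sum. *)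

theory Submission
  imports Defs
begin

section \<open>Noetherian subrings and integrality\<close>

text \<open>The values in the definitions are read off from powers of \<open>P\<close> inside the
  integral closure, so those powers must be controlled before any inequality can be used. This is
  done one prime at a time, in the local ring at \<open>P\<close>: an element of \<open>P\<close>
  whose power divides \<open>\<pi>\<close> with the largest possible exponent is a local generator,
  and since \<open>P\<close> is maximal its powers agree with its symbolic powers, so that the
  ideal-theoretic value becomes an exponent of that generator. Integrality arguments rest on one
  principle: if all \<open>y * z ^ n\<close> with \<open>y\<close> nonzero lie in a Noetherian
  module, then \<open>z\<close> is integral. Floors enter because the values at elements of the
  extension are fractional, with denominators depending on the prime, whereas a scalar from
  \<open>K\<close> translates all of them by one and the same integer, and integer translations
  commute with the floor. In the final comparison the block attaining the minimum has value in
  \<open>[m, m + 1)\<close> at its own prime and the other terms only reach \<open>m + 1\<close>, so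
  it is the floor of the sum that is determined, not its exact value under
  \<open>wS\<close>.\<close>

locale subring =
  fixes R :: "'a::field set"
  assumes subring_of: "subring_of R"
begin

lemma zero_mem: "0 \<in> R"
  and one_mem: "1 \<in> R"
  and add_mem: "x \<in> R \<Longrightarrow> y \<in> R \<Longrightarrow> x + y \<in> R"
  and diff_mem: "x \<in> R \<Longrightarrow> y \<in> R \<Longrightarrow> x - y \<in> R"
  and mult_mem: "x \<in> R \<Longrightarrow> y \<in> R \<Longrightarrow> x * y \<in> R"
  using subring_of unfolding subring_of_def by auto

lemma uminus_mem: "x \<in> R \<Longrightarrow> - x \<in> R"
  using diff_mem[OF zero_mem] by force

lemma power_mem: "x \<in> R \<Longrightarrow> x ^ n \<in> R"
  by (induction n) (auto intro: one_mem mult_mem)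

lemma sum_mem: "(\<And>i. i \<in> I \<Longrightarrow> f i \<in> R) \<Longrightarrow> sum f I \<in> R"
  by (induction I rule: infinite_finite_induct) (auto intro: zero_mem add_mem)

lemma prod_mem: "(\<And>i. i \<in> I \<Longrightarrow> f i \<in> R) \<Longrightarrow> prod f I \<in> R"
  by (induction I rule: infinite_finite_induct) (auto intro: one_mem mult_mem)

lemma poly_mem: "(\<And>i. coeff g i \<in> R) \<Longrightarrow> x \<in> R \<Longrightarrow> poly g x \<in> R"
  unfolding poly_altdef by (intro sum_mem mult_mem power_mem)

text \<open>For finite \<open>G\<close> the set \<open>ideal_gen R G\<close> is the
  \<open>R\<close>-submodule of the ambient field spanned by \<open>G\<close>; it serves as an
  ideal, as a finite module of integral elements and as a span over a field.\<close>

lemma ideal_gen_zero: "0 \<in> ideal_gen R G"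
  unfolding ideal_gen_def using zero_mem by (auto intro!: exI[of _ "\<lambda>_. 0"])

lemma ideal_gen_add:
  assumes "x \<in> ideal_gen R G" "y \<in> ideal_gen R G"
  shows "x + y \<in> ideal_gen R G"
proof -
  obtain r q where "x = (\<Sum>g\<in>G. r g * g)" "\<forall>g\<in>G. r g \<in> R"
    "y = (\<Sum>g\<in>G. q g * g)" "\<forall>g\<in>G. q g \<in> R"
    using assms unfolding ideal_gen_def by auto
  then show ?thesis
    unfolding ideal_gen_def
    by (auto intro!: exI[of _ "\<lambda>g. r g + q g"] add_mem simp: sum.distrib algebra_simps)
qed

lemma ideal_gen_smult:
  assumes "c \<in> R" "x \<in> ideal_gen R G"
  shows "c * x \<in> ideal_gen R G"
proof -
  obtain r where "x = (\<Sum>g\<in>G. r g * g)" "\<forall>g\<in>G. r g \<in> R"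
    using assms unfolding ideal_gen_def by auto
  then show ?thesis
    unfolding ideal_gen_def using assms
    by (auto intro!: exI[of _ "\<lambda>g. c * r g"] mult_mem simp: sum_distrib_left algebra_simps)
qed

lemma ideal_gen_diff:
  assumes "x \<in> ideal_gen R G" "y \<in> ideal_gen R G"
  shows "x - y \<in> ideal_gen R G"
  using ideal_gen_add[OF assms(1) ideal_gen_smult[OF uminus_mem[OF one_mem] assms(2)]] by simp

lemma ideal_gen_sum:
  "(\<And>i. i \<in> I \<Longrightarrow> f i \<in> ideal_gen R G) \<Longrightarrow> sum f I \<in> ideal_gen R G"
  by (induction I rule: infinite_finite_induct) (auto intro: ideal_gen_zero ideal_gen_add)

lemma ideal_gen_base:
  assumes "finite G" "g \<in> G"
  shows "g \<in> ideal_gen R G"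
proof -
  have "(\<Sum>h\<in>G. (if h = g then 1 else 0) * h) = (\<Sum>h\<in>G. if h = g then h else 0)"
    by (intro sum.cong) auto
  also have "\<dots> = g"
    using assms by simp
  finally show ?thesis
    unfolding ideal_gen_def using zero_mem one_mem
    by (auto intro!: exI[of _ "\<lambda>h. if h = g then 1 else 0"])
qed

lemma ideal_gen_least:
  assumes "F \<subseteq> M" "0 \<in> M" "\<And>x y. x \<in> M \<Longrightarrow> y \<in> M \<Longrightarrow> x + y \<in> M"
    "\<And>r x. r \<in> R \<Longrightarrow> x \<in> M \<Longrightarrow> r * x \<in> M"
  shows "ideal_gen R F \<subseteq> M"
proof -
  have sum: "sum f I \<in> M" if "\<And>i. i \<in> I \<Longrightarrow> f i \<in> M" for f :: "'a \<Rightarrow> 'a" and I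
    using that by (induction I rule: infinite_finite_induct) (auto intro: assms)
  show ?thesis
    unfolding ideal_gen_def using assms(1) by (auto intro!: sum assms(4))
qed

lemma ideal_gen_mono:
  assumes "F \<subseteq> ideal_gen R G"
  shows "ideal_gen R F \<subseteq> ideal_gen R G"
  using assms by (intro ideal_gen_least) (auto intro: ideal_gen_zero ideal_gen_add ideal_gen_smult)

lemma ideal_gen_insertE:
  assumes "finite G" "g \<notin> G" "x \<in> ideal_gen R (insert g G)"
  obtains r y where "r \<in> R" "y \<in> ideal_gen R G" "x = r * g + y"
proof -
  obtain r where r: "x = (\<Sum>h\<in>insert g G. r h * h)" "\<forall>h\<in>insert g G. r h \<in> R"
    using assms(3) unfolding ideal_gen_def by auto
  have "x = r g * g + (\<Sum>h\<in>G. r h * h)"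
    using r assms by simp
  moreover have "(\<Sum>h\<in>G. r h * h) \<in> ideal_gen R G"
    using r unfolding ideal_gen_def by auto
  ultimately show ?thesis
    using r that by blast
qed

text \<open>The family \<open>x\<close> may repeat values, so coefficients on its image cannot
  simply be pulled back to indices. Instead the combinations of the family form a submodule that
  contains the generators.\<close>

lemma ideal_gen_image_lessThan:
  fixes x :: "nat \<Rightarrow> 'a"
  assumes "y \<in> ideal_gen R (x ` {..<N})"
  shows "\<exists>r. (\<forall>i. r i \<in> R) \<and> y = (\<Sum>i<N. r i * x i)"
proof -
  have "ideal_gen R (x ` {..<N}) \<subseteq> {\<Sum>i<N. r i * x i | r. \<forall>i. r i \<in> R}"
  proof (rule ideal_gen_least)
    show "x ` {..<N} \<subseteq> {\<Sum>i<N. r i * x i | r. \<forall>i. r i \<in> R}"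
    proof
      fix y assume "y \<in> x ` {..<N}"
      then obtain k where k: "k < N" "y = x k"
        by auto
      have "(\<Sum>i<N. (if i = k then 1 else 0) * x i) = (\<Sum>i<N. if i = k then x i else 0)"
        by (intro sum.cong) auto
      also have "\<dots> = y"
        using k by simp
      finally show "y \<in> {\<Sum>i<N. r i * x i | r. \<forall>i. r i \<in> R}"
        using zero_mem one_mem by (auto intro!: exI[of _ "\<lambda>i. if i = k then 1 else 0"])
    qed
  next
    show "0 \<in> {\<Sum>i<N. r i * x i | r. \<forall>i. r i \<in> R}"
      using zero_mem by (auto intro!: exI[of _ "\<lambda>_. 0"])
  next
    fix a b
    assume "a \<in> {\<Sum>i<N. r i * x i | r. \<forall>i. r i \<in> R}" "b \<in> {\<Sum>i<N. r i * x i | r. \<forall>i. r i \<in> R}"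
    then obtain r q where "a = (\<Sum>i<N. r i * x i)" "\<forall>i. r i \<in> R"
      "b = (\<Sum>i<N. q i * x i)" "\<forall>i. q i \<in> R"
      by auto
    then show "a + b \<in> {\<Sum>i<N. r i * x i | r. \<forall>i. r i \<in> R}"
      by (auto intro!: exI[of _ "\<lambda>i. r i + q i"] add_mem simp: sum.distrib algebra_simps)
  next
    fix c a
    assume "c \<in> R" "a \<in> {\<Sum>i<N. r i * x i | r. \<forall>i. r i \<in> R}"
    then obtain r where "a = (\<Sum>i<N. r i * x i)" "\<forall>i. r i \<in> R"
      by auto
    then show "c * a \<in> {\<Sum>i<N. r i * x i | r. \<forall>i. r i \<in> R}"
      using \<open>c \<in> R\<close>
      by (auto intro!: exI[of _ "\<lambda>i. c * r i"] mult_mem simp: sum_distrib_left algebra_simps)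
  qed
  then show ?thesis
    using assms by blast
qed

lemma ideal_gen_stable:
  assumes "\<And>g. g \<in> G \<Longrightarrow> x * g \<in> ideal_gen R G" "y \<in> ideal_gen R G"
  shows "x * y \<in> ideal_gen R G"
proof -
  obtain r where r: "y = (\<Sum>g\<in>G. r g * g)" "\<forall>g\<in>G. r g \<in> R"
    using assms(2) unfolding ideal_gen_def by auto
  have "x * y = (\<Sum>g\<in>G. r g * (x * g))"
    unfolding r(1) by (simp add: sum_distrib_left mult_ac)
  also have "\<dots> \<in> ideal_gen R G"
    using r assms(1) by (intro ideal_gen_sum ideal_gen_smult[of _ "x * _"]) auto
  finally show ?thesis .
qed

lemma integral_overI:
  assumes "\<And>i. r i \<in> R" "z ^ N = (\<Sum>i<N. r i * z ^ i)"
  shows "integral_over R z"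
proof -
  define g where "g = monom 1 N - (\<Sum>i<N. monom (r i) i)"
  have coeff_sum: "coeff (\<Sum>i<N. monom (r i) i) j = (if j < N then r j else 0)" for j
    by (auto simp: coeff_sum coeff_monom)
  have coeff_g: "coeff g j = (if j = N then 1 else if j < N then - r j else 0)" for j
    unfolding g_def by (simp add: coeff_sum coeff_monom)
  have "degree g = N"
    by (rule order.antisym[OF degree_le le_degree]) (auto simp: coeff_g)
  then have "lead_coeff g = 1"
    by (simp add: coeff_g)
  moreover have "coeff g j \<in> R" for j
    by (auto simp: coeff_g intro: zero_mem one_mem uminus_mem assms)
  moreover have "poly g z = 0"
    using assms(2) unfolding g_def by (simp add: poly_sum poly_monom)
  ultimately show ?thesis
    unfolding integral_over_def by blast
qed

lemma integral_overE:
  assumes "integral_over R z"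
  obtains r N where "\<And>i. r i \<in> R" "N > 0" "z ^ N = (\<Sum>i<N. r i * z ^ i)"
proof -
  obtain g where g: "lead_coeff g = 1" "\<forall>i. coeff g i \<in> R" "poly g z = 0"
    using assms unfolding integral_over_def by auto
  have "(\<Sum>i<degree g. coeff g i * z ^ i) + z ^ degree g = 0"
    using g unfolding poly_altdef by (simp add: lessThan_Suc_atMost[symmetric])
  then have eq: "z ^ degree g = (\<Sum>i<degree g. - coeff g i * z ^ i)"
    by (simp add: sum_negf eq_neg_iff_add_eq_0 add.commute)
  \<comment> \<open>In degree 0 the relation would read \<open>1 = 0\<close>.\<close>
  moreover have "degree g > 0"
    using eq by (cases "degree g") auto
  ultimately show ?thesis
    using that[of "\<lambda>i. - coeff g i"] g uminus_mem by blast
qed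

text \<open>The ascending chain condition in terms of sequences of elements.\<close>

definition seq_noetherian :: "'a set \<Rightarrow> bool" where
  "seq_noetherian M \<longleftrightarrow>
     (\<forall>x :: nat \<Rightarrow> 'a. range x \<subseteq> M \<longrightarrow> (\<exists>N. range x \<subseteq> ideal_gen R (x ` {..<N})))"

text \<open>Some \<open>y * z ^ N\<close> is an \<open>R\<close>-combination of the earlier ones,
  and cancelling \<open>y\<close> leaves a monic relation for \<open>z\<close>. It is used with
  \<open>y = 1\<close> for elements that stabilize a finite module, and with \<open>y\<close> in
  \<open>A\<close> for the fraction \<open>u\<close>.\<close>

lemma integral_if_powers_mem:
  assumes "seq_noetherian M" "y \<noteq> 0" "\<And>n. y * z ^ n \<in> M"
  shows "integral_over R z"
proof -
  have "range (\<lambda>n. y * z ^ n) \<subseteq> M"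
    using assms by auto
  then obtain N where "range (\<lambda>n. y * z ^ n) \<subseteq> ideal_gen R ((\<lambda>n. y * z ^ n) ` {..<N})"
    using assms(1) unfolding seq_noetherian_def by meson
  then have "y * z ^ N \<in> ideal_gen R ((\<lambda>n. y * z ^ n) ` {..<N})"
    by auto
  then obtain r where r: "\<And>i. r i \<in> R" "y * z ^ N = (\<Sum>i<N. r i * (y * z ^ i))"
    using ideal_gen_image_lessThan by meson
  have "y * z ^ N = y * (\<Sum>i<N. r i * z ^ i)"
    using r(2) by (simp add: sum_distrib_left mult_ac)
  then show ?thesis
    using integral_overI[OF r(1)] assms(2) by simp
qed

end

locale noetherian_subring = subring +
  assumes ideal_fg: "ideal_of R I \<Longrightarrow> \<exists>F. finite F \<and> F \<subseteq> I \<and> I = ideal_gen R F"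
begin

text \<open>The spans of the initial segments form an ascending chain whose union is an ideal;
  finitely many generators of that ideal already lie in one member of the chain.\<close>

lemma seq_noetherian_self: "seq_noetherian R"
  unfolding seq_noetherian_def
proof (intro allI impI)
  fix x :: "nat \<Rightarrow> 'a"
  assume x: "range x \<subseteq> R"
  define S where "S N = ideal_gen R (x ` {..<N})" for N
  have S_R: "S N \<subseteq> R" for N
    unfolding S_def using x by (intro ideal_gen_least) (auto intro: zero_mem add_mem mult_mem)
  have S_mono: "S M \<subseteq> S N" if "M \<le> N" for M N
    unfolding S_def using that by (intro ideal_gen_mono) (auto intro!: ideal_gen_base)
  have "ideal_of R (\<Union>N. S N)"
    unfolding ideal_of_def
  proof (intro conjI ballI)
    show "(\<Union>N. S N) \<subseteq> R"
      using S_R by auto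
    show "0 \<in> (\<Union>N. S N)"
      unfolding S_def using ideal_gen_zero by auto
  next
    fix a b assume "a \<in> (\<Union>N. S N)" "b \<in> (\<Union>N. S N)"
    then obtain M N where "a \<in> S M" "b \<in> S N"
      by auto
    then have "a \<in> S (max M N)" "b \<in> S (max M N)"
      using S_mono[of M "max M N"] S_mono[of N "max M N"] by auto
    then show "a + b \<in> (\<Union>N. S N)"
      unfolding S_def using ideal_gen_add by blast
  next
    fix r a assume "r \<in> R" "a \<in> (\<Union>N. S N)"
    then show "r * a \<in> (\<Union>N. S N)"
      unfolding S_def using ideal_gen_smult by blast
  qed
  then obtain F where F: "finite F" "F \<subseteq> (\<Union>N. S N)" "(\<Union>N. S N) = ideal_gen R F"
    using ideal_fg by metis
  have "\<exists>N. F \<subseteq> S N"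
    using F(1,2)
  proof (induction F rule: finite_induct)
    case (insert a F)
    then obtain M N where "F \<subseteq> S M" "a \<in> S N"
      by auto
    then have "insert a F \<subseteq> S (max M N)"
      using S_mono[of M "max M N"] S_mono[of N "max M N"] by auto
    then show ?case ..
  qed auto
  then obtain N where "F \<subseteq> S N" ..
  then have "ideal_gen R F \<subseteq> S N"
    unfolding S_def by (rule ideal_gen_mono)
  moreover have "x n \<in> S (Suc n)" for n
    unfolding S_def by (intro ideal_gen_base) auto
  ultimately show "\<exists>N. range x \<subseteq> ideal_gen R (x ` {..<N})"
    using F(3) unfolding S_def by blast
qed

text \<open>Induction on the generators: the \<open>g\<close>-coefficients of the sequence are
  combinations of finitely many of them, and subtracting the matching combination of early terms
  from each term leaves a sequence in the span of \<open>G\<close>.\<close>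

lemma seq_noetherian_ideal_gen:
  assumes "finite G"
  shows "seq_noetherian (ideal_gen R G)"
  using assms
proof (induction G rule: finite_induct)
  case empty
  have "range x \<subseteq> ideal_gen R (x ` {..<0::nat})" if "range x \<subseteq> ideal_gen R {}" for x
    using that by simp
  then show ?case
    unfolding seq_noetherian_def by blast
next
  case (insert g G)
  show ?case
    unfolding seq_noetherian_def
  proof (intro allI impI)
    fix x :: "nat \<Rightarrow> 'a"
    assume x: "range x \<subseteq> ideal_gen R (insert g G)"
    have "\<exists>a y. a \<in> R \<and> y \<in> ideal_gen R G \<and> x n = a * g + y" for n
      using ideal_gen_insertE[OF insert(1,2), of "x n"] x by blast
    then obtain a y where ay: "\<And>n. a n \<in> R" "\<And>n. y n \<in> ideal_gen R G" "\<And>n. x n = a n * g + y n"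
      by metis
    have "range a \<subseteq> R"
      using ay by auto
    then obtain N where N: "range a \<subseteq> ideal_gen R (a ` {..<N})"
      using seq_noetherian_self unfolding seq_noetherian_def by meson
    have "\<exists>r. (\<forall>i. r i \<in> R) \<and> a n = (\<Sum>i<N. r i * a i)" for n
      using N by (intro ideal_gen_image_lessThan) auto
    then obtain r where r: "\<And>n i. r n i \<in> R" "\<And>n. a n = (\<Sum>i<N. r n i * a i)"
      by metis
    define y' where "y' n = x n - (\<Sum>i<N. r n i * x i)" for n
    have "y' n = y n - (\<Sum>i<N. r n i * y i)" for n
    proof -
      have "(\<Sum>i<N. r n i * x i) = (\<Sum>i<N. r n i * a i) * g + (\<Sum>i<N. r n i * y i)"
        by (simp add: ay(3) sum_distrib_left sum.distrib algebra_simps)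
      then show ?thesis
        unfolding y'_def r(2)[symmetric] by (simp add: ay(3))
    qed
    then have "range y' \<subseteq> ideal_gen R G"
      using ay(2) r(1) by (auto intro!: ideal_gen_diff ideal_gen_sum ideal_gen_smult)
    then obtain N' where N': "range y' \<subseteq> ideal_gen R (y' ` {..<N'})"
      using insert.IH unfolding seq_noetherian_def by meson
    define M where "M = max N N'"
    have x_mem: "x i \<in> ideal_gen R (x ` {..<M})" if "i < M" for i
      using that by (intro ideal_gen_base) auto
    have sum_mem: "(\<Sum>i<N. r n i * x i) \<in> ideal_gen R (x ` {..<M})" for n
      using r(1) by (intro ideal_gen_sum ideal_gen_smult x_mem) (auto simp: M_def)
    have "y' ` {..<N'} \<subseteq> ideal_gen R (x ` {..<M})"
      unfolding y'_def using x_mem sum_mem by (auto intro!: ideal_gen_diff simp: M_def)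
    then have "range y' \<subseteq> ideal_gen R (x ` {..<M})"
      using N' ideal_gen_mono by blast
    then have "x n \<in> ideal_gen R (x ` {..<M})" for n
      using ideal_gen_add[OF _ sum_mem, of "y' n" n] unfolding y'_def by force
    then show "\<exists>N. range x \<subseteq> ideal_gen R (x ` {..<N})"
      by blast
  qed
qed

text \<open>Stability puts every power of \<open>z\<close> into a finitely generated, hence
  Noetherian, module; the ascending chain condition takes the place of the determinant
  trick.\<close>

lemma integral_if_stable:
  assumes "finite G" "1 \<in> ideal_gen R G" "\<And>m. m \<in> ideal_gen R G \<Longrightarrow> z * m \<in> ideal_gen R G"
  shows "integral_over R z"
proof (rule integral_if_powers_mem[OF seq_noetherian_ideal_gen[OF assms(1)] one_neq_zero])
  show "1 * z ^ n \<in> ideal_gen R G" for n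
    using assms(2,3) by (induction n) auto
qed

text \<open>The monomials \<open>x ^ i * y ^ j\<close> below the degrees of the two monic relations
  span a module that contains 1 and is stable under \<open>x\<close> and \<open>y\<close>, hence
  under their sum, difference and product.\<close>

lemma integral_ring_ops:
  assumes "integral_over R x" "integral_over R y"
  shows integral_add: "integral_over R (x + y)"
    and integral_diff: "integral_over R (x - y)"
    and integral_mult: "integral_over R (x * y)"
proof -
  obtain r m where r: "\<And>i. r i \<in> R" "m > 0" "x ^ m = (\<Sum>i<m. r i * x ^ i)"
    using integral_overE[OF assms(1)] by metis
  obtain q n where q: "\<And>i. q i \<in> R" "n > 0" "y ^ n = (\<Sum>i<n. q i * y ^ i)"
    using integral_overE[OF assms(2)] by metis
  define G where "G = (\<lambda>(i, j). x ^ i * y ^ j) ` ({..<m} \<times> {..<n})"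
  have fin: "finite G"
    unfolding G_def by auto
  have G_mem: "x ^ i * y ^ j \<in> ideal_gen R G" if "i < m" "j < n" for i j
    using that by (intro ideal_gen_base[OF fin]) (auto simp: G_def)
  have one: "1 \<in> ideal_gen R G"
    using G_mem[of 0 0] r q by simp
  have "x * (x ^ i * y ^ j) \<in> ideal_gen R G" if "i < m" "j < n" for i j
  proof (cases "Suc i = m")
    case True
    have "x * (x ^ i * y ^ j) = x ^ m * y ^ j"
      using True by auto
    also have "\<dots> = (\<Sum>i<m. r i * (x ^ i * y ^ j))"
      by (subst r(3)) (simp add: sum_distrib_right mult.assoc)
    finally show ?thesis
      using that r(1) by (auto intro!: ideal_gen_sum ideal_gen_smult G_mem)
  next
    case False
    then show ?thesis
      using that G_mem[of "Suc i" j] by (simp add: mult_ac)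
  qed
  then have x: "x * g \<in> ideal_gen R G" if "g \<in> ideal_gen R G" for g
    using that by (rule_tac ideal_gen_stable) (auto simp: G_def)
  have "y * (x ^ i * y ^ j) \<in> ideal_gen R G" if "i < m" "j < n" for i j
  proof (cases "Suc j = n")
    case True
    have "y * (x ^ i * y ^ j) = x ^ i * y ^ n"
      using True by auto
    also have "\<dots> = (\<Sum>j<n. q j * (x ^ i * y ^ j))"
      by (subst q(3)) (simp add: sum_distrib_left mult_ac)
    finally show ?thesis
      using that q(1) by (auto intro!: ideal_gen_sum ideal_gen_smult G_mem)
  next
    case False
    then show ?thesis
      using that G_mem[of i "Suc j"] by (simp add: mult_ac)
  qed
  then have y: "y * g \<in> ideal_gen R G" if "g \<in> ideal_gen R G" for g
    using that by (rule_tac ideal_gen_stable) (auto simp: G_def)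
  show "integral_over R (x + y)" "integral_over R (x - y)" "integral_over R (x * y)"
    by (auto intro!: integral_if_stable[OF fin one] ideal_gen_add ideal_gen_diff x y
        simp: distrib_right left_diff_distrib mult.assoc)
qed

lemma integral_self: "x \<in> R \<Longrightarrow> integral_over R x"
  using integral_overI[of "\<lambda>_. x" x 1] by simp

end

section \<open>Primes of a Dedekind domain\<close>

locale prime_subring = subring +
  fixes P :: "'a set"
  assumes prime_ideal: "prime_ideal_of R P"
begin

lemma prime_subset: "P \<subseteq> R"
  and prime_zero: "0 \<in> P"
  and prime_add: "x \<in> P \<Longrightarrow> y \<in> P \<Longrightarrow> x + y \<in> P"
  and prime_smult: "r \<in> R \<Longrightarrow> x \<in> P \<Longrightarrow> r * x \<in> P"
  and prime_cases: "a \<in> R \<Longrightarrow> b \<in> R \<Longrightarrow> a * b \<in> P \<Longrightarrow> a \<in> P \<or> b \<in> P"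
  and prime_neq: "P \<noteq> R"
  using prime_ideal unfolding prime_ideal_of_def ideal_of_def by auto

lemma prime_smult2: "x \<in> P \<Longrightarrow> r \<in> R \<Longrightarrow> x * r \<in> P"
  using prime_smult[of r x] by (simp add: mult.commute)

lemma prime_diff: "x \<in> P \<Longrightarrow> y \<in> P \<Longrightarrow> x - y \<in> P"
  using prime_add[of x "- 1 * y"] prime_smult[of "- 1" y] uminus_mem one_mem by auto

lemma one_not_prime: "1 \<notin> P"
  using prime_smult[of _ 1] prime_subset prime_neq by auto

lemma compl_mult: "a \<in> R - P \<Longrightarrow> b \<in> R - P \<Longrightarrow> a * b \<in> R - P"
  using prime_cases mult_mem by auto

lemma compl_one: "1 \<in> R - P"
  using one_mem one_not_prime by simp

lemma compl_power: "a \<in> R - P \<Longrightarrow> a ^ n \<in> R - P"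
proof (induction n)
  case 0
  then show ?case using compl_one by simp
next
  case (Suc n)
  then show ?case using compl_mult[of a "a ^ n"] by simp
qed

lemma compl_prod: "finite I \<Longrightarrow> (\<And>i. i \<in> I \<Longrightarrow> f i \<in> R - P) \<Longrightarrow> prod f I \<in> R - P"
proof (induction I rule: finite_induct)
  case empty
  then show ?case using compl_one by simp
next
  case (insert i I)
  then show ?case using compl_mult[of "f i" "prod f I"] by simp
qed

lemma compl_nonzero: "a \<in> R - P \<Longrightarrow> a \<noteq> 0"
  using prime_zero by auto

section \<open>Localization at a prime ideal, inside the ambient field\<close>

definition loc :: "'a set" where
  "loc = {a / b | a b. a \<in> R \<and> b \<in> R - P}"

text \<open>The maximal ideal of the local ring \<open>loc\<close>: by \<open>loc_cases\<close>
  every other element of \<open>loc\<close> is invertible in it.\<close>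

definition loc_max :: "'a set" where
  "loc_max = {a / b | a b. a \<in> P \<and> b \<in> R - P}"

lemma locI: "a \<in> R \<Longrightarrow> b \<in> R - P \<Longrightarrow> a / b \<in> loc"
  unfolding loc_def by blast

lemma subset_loc: "R \<subseteq> loc"
  using locI[OF _ compl_one] by auto

lemma loc_maxI: "a \<in> P \<Longrightarrow> b \<in> R - P \<Longrightarrow> a / b \<in> loc_max"
  unfolding loc_max_def by blast

lemma prime_subset_loc_max: "P \<subseteq> loc_max"
  using loc_maxI[OF _ compl_one] by auto

lemma subring_loc: "subring_of loc"
  unfolding subring_of_def
proof (intro conjI ballI)
  show "0 \<in> loc" "1 \<in> loc"
    using subset_loc zero_mem one_mem by auto
  fix x y assume "x \<in> loc" "y \<in> loc"
  then obtain a b c d where *: "x = a / b" "y = c / d" "a \<in> R" "b \<in> R - P" "c \<in> R" "d \<in> R - P"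
    unfolding loc_def by blast
  then have nz: "b \<noteq> 0" "d \<noteq> 0"
    using compl_nonzero by auto
  have bd: "b * d \<in> R - P"
    using * compl_mult by auto
  have "x + y = (a * d + c * b) / (b * d)" "x - y = (a * d - c * b) / (b * d)"
    "x * y = (a * c) / (b * d)"
    using * nz by (auto simp: add_frac_eq diff_frac_eq)
  then show "x + y \<in> loc" "x - y \<in> loc" "x * y \<in> loc"
    using * bd by (auto intro!: locI add_mem diff_mem mult_mem)
qed

lemma inverse_loc: "a \<in> R - P \<Longrightarrow> inverse a \<in> loc"
  using locI[OF one_mem] by (simp add: divide_inverse)

lemma loc_cases:
  assumes "x \<in> loc"
  shows "x \<in> loc_max \<or> inverse x \<in> loc"
proof -
  obtain a b where ab: "x = a / b" "a \<in> R" "b \<in> R - P"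
    using assms unfolding loc_def by blast
  then show ?thesis
    using loc_maxI[of a b] locI[of b a] by (cases "a \<in> P") auto
qed

lemma loc_max_Int: "x \<in> loc_max \<Longrightarrow> x \<in> R \<Longrightarrow> x \<in> P"
proof -
  assume "x \<in> loc_max" "x \<in> R"
  then obtain a b where ab: "x = a / b" "a \<in> P" "b \<in> R - P"
    unfolding loc_max_def by blast
  then have "x * b \<in> P"
    using compl_nonzero[of b] by auto
  then show "x \<in> P"
    using prime_cases[of x b] \<open>x \<in> R\<close> ab by auto
qed

lemma loc_max_mult:
  assumes "x \<in> loc_max" "y \<in> loc"
  shows "x * y \<in> loc_max"
proof -
  obtain a b c d where *: "x = a / b" "y = c / d" "a \<in> P" "b \<in> R - P" "c \<in> R" "d \<in> R - P"
    using assms unfolding loc_def loc_max_def by blast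
  then have "x * y = (a * c) / (b * d)" "a * c \<in> P" "b * d \<in> R - P"
    using compl_mult[of b d] prime_smult2 by auto
  then show ?thesis
    using loc_maxI by metis
qed

end

section \<open>A uniformizer of a Dedekind domain at a nonzero prime\<close>

locale dedekind_prime = prime_subring A p for A p :: "'a::field set" +
  assumes dedekind: "dedekind_domain A"
    and prime_nonzero: "p \<noteq> {0}"
begin

sublocale noetherian_subring A
  using dedekind by unfold_locales (auto simp: dedekind_domain_def)

lemma prime_maximal: "ideal_of A J \<Longrightarrow> p \<subseteq> J \<Longrightarrow> J = p \<or> J = A"
  using dedekind prime_ideal prime_nonzero unfolding dedekind_domain_def by blast

lemma nonzero_prime_maximal:
  "prime_ideal_of A q \<Longrightarrow> q \<noteq> {0} \<Longrightarrow> ideal_of A J \<Longrightarrow> q \<subseteq> J \<Longrightarrow> J = q \<or> J = A"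
  using dedekind unfolding dedekind_domain_def by blast

lemma integrally_closed: "x \<in> frac_field A \<Longrightarrow> integral_over A x \<Longrightarrow> x \<in> A"
  using dedekind unfolding dedekind_domain_def by blast

text \<open>The ideal generated by \<open>a\<close> and \<open>p\<close> is strictly larger than
  \<open>p\<close>, so by maximality it contains 1.\<close>

lemma inverse_mod_prime:
  assumes "a \<in> A - p"
  shows "\<exists>b\<in>A. a * b - 1 \<in> p"
proof -
  define J where "J = {a * r + q | r q. r \<in> A \<and> q \<in> p}"
  have "ideal_of A J"
    unfolding ideal_of_def
  proof (intro conjI ballI)
    show "J \<subseteq> A"
      using assms prime_subset unfolding J_def by (auto intro: add_mem mult_mem)
    show "0 \<in> J"
      unfolding J_def using zero_mem prime_zero by force
  next
    fix x y assume "x \<in> J" "y \<in> J"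
    then obtain r q r' q' where "x = a * r + q" "r \<in> A" "q \<in> p" "y = a * r' + q'" "r' \<in> A" "q' \<in> p"
      unfolding J_def by blast
    then have "x + y = a * (r + r') + (q + q')" "r + r' \<in> A" "q + q' \<in> p"
      by (auto simp: algebra_simps intro: add_mem prime_add)
    then show "x + y \<in> J"
      unfolding J_def by blast
  next
    fix c x assume "c \<in> A" "x \<in> J"
    then obtain r q where "x = a * r + q" "r \<in> A" "q \<in> p"
      unfolding J_def by blast
    then have "c * x = a * (c * r) + c * q" "c * r \<in> A" "c * q \<in> p"
      using \<open>c \<in> A\<close> by (auto simp: algebra_simps intro: mult_mem prime_smult)
    then show "c * x \<in> J"
      unfolding J_def by blast
  qed
  moreover have "p \<subseteq> J"
  proof
    fix q assume "q \<in> p"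
    then have "q = a * 0 + q" "0 \<in> A"
      using zero_mem by auto
    then show "q \<in> J"
      unfolding J_def using \<open>q \<in> p\<close> by blast
  qed
  moreover have "a * 1 + 0 \<in> J"
    unfolding J_def using one_mem prime_zero by blast
  then have "J \<noteq> p"
    using assms by auto
  ultimately have "1 \<in> J"
    using prime_maximal one_mem by blast
  then obtain r q where "1 = a * r + q" "r \<in> A" "q \<in> p"
    unfolding J_def by blast
  then have "a * r - 1 = 0 - q" "r \<in> A" "0 - q \<in> p"
    using prime_diff[OF prime_zero] by (auto simp: algebra_simps)
  then show ?thesis
    by metis
qed

text \<open>A maximal one among the annihilators of nonzero elements of \<open>A\<^sub>p / a A\<^sub>p\<close>
  is prime, hence equal to \<open>p\<close>.\<close>

lemma ex_fraction_multiplying_prime_into_ring: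
  "\<exists>u\<in>frac_field A. u \<notin> A \<and> (\<forall>x\<in>p. u * x \<in> A)"
proof -
  obtain a where a: "a \<in> p" "a \<noteq> 0"
    using prime_zero prime_nonzero by blast
  have aA: "a \<in> A"
    using a prime_subset by auto
  \<comment> \<open>\<open>I c\<close> is the annihilator of the class of \<open>c\<close> modulo
    \<open>a\<close> in the localization at \<open>p\<close>, with the denominator \<open>s\<close>
    cleared; \<open>C\<close> collects the \<open>c\<close> whose class is nonzero.\<close>
  define I where "I c = {x \<in> A. \<exists>s\<in>A - p. \<exists>r\<in>A. s * x * c = a * r}" for c
  define C where "C = {c \<in> A. 1 \<notin> I c}"
  have I_ideal: "ideal_of A (I c)" if "c \<in> A" for c
    unfolding ideal_of_def
  proof (intro conjI ballI)
    show "I c \<subseteq> A"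
      by (auto simp: I_def)
    show "0 \<in> I c"
      unfolding I_def using zero_mem compl_one by auto
  next
    fix x y assume "x \<in> I c" "y \<in> I c"
    then obtain s r s' r' where *: "x \<in> A" "s \<in> A - p" "r \<in> A" "s * x * c = a * r"
      "y \<in> A" "s' \<in> A - p" "r' \<in> A" "s' * y * c = a * r'"
      unfolding I_def by blast
    have "(s * s') * (x + y) * c = s' * (s * x * c) + s * (s' * y * c)"
      by (simp add: algebra_simps)
    also have "\<dots> = a * (s' * r + s * r')"
      unfolding * by (simp add: algebra_simps)
    finally have "(s * s') * (x + y) * c = a * (s' * r + s * r')" .
    moreover have "s' * r + s * r' \<in> A" "s * s' \<in> A - p" "x + y \<in> A"
      using * compl_mult[of s s'] by (auto intro: add_mem mult_mem)
    ultimately show "x + y \<in> I c"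
      unfolding I_def by blast
  next
    fix r x assume "r \<in> A" "x \<in> I c"
    then obtain s q where *: "x \<in> A" "s \<in> A - p" "q \<in> A" "s * x * c = a * q"
      unfolding I_def by blast
    have "s * (r * x) * c = r * (s * x * c)"
      by (simp add: algebra_simps)
    then have "s * (r * x) * c = a * (r * q)"
      unfolding * by (simp add: algebra_simps)
    moreover have "r * q \<in> A" "r * x \<in> A"
      using * \<open>r \<in> A\<close> by (auto intro: mult_mem)
    ultimately show "r * x \<in> I c"
      unfolding I_def using * by blast
  qed
  \<comment> \<open>Without a maximal annihilator one could choose a strictly ascending sequence of
    them, against the chain condition. The sequence can start at 1, whose class is nonzero because
    \<open>a\<close> lies in \<open>p\<close>.\<close>
  have "\<exists>c\<in>C. \<forall>d\<in>C. \<not> I c \<subset> I d"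
  proof (rule ccontr)
    assume "\<not> ?thesis"
    then obtain nxt where nxt: "\<And>c. c \<in> C \<Longrightarrow> nxt c \<in> C" "\<And>c. c \<in> C \<Longrightarrow> I c \<subset> I (nxt c)"
      by metis
    have "1 \<in> C"
    proof -
      have "s \<in> p" if "s \<in> A" "r \<in> A" "s = a * r" for s r
        using that a prime_smult2 by auto
      then show ?thesis
        unfolding C_def I_def using one_mem by auto
    qed
    define c where "c n = (nxt ^^ n) 1" for n
    have c: "c n \<in> C" for n
      unfolding c_def using \<open>1 \<in> C\<close> nxt by (induction n) auto
    have step: "I (c n) \<subset> I (c (Suc n))" for n
      using nxt(2)[OF c[of n]] by (simp add: c_def)
    have mono: "I (c m) \<subseteq> I (c n)" if "m \<le> n" for m n
      by (rule lift_Suc_mono_le[OF _ that]) (use step in auto)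
    have "\<exists>x. x \<in> I (c (Suc n)) \<and> x \<notin> I (c n)" for n
      using step by blast
    then obtain x where x: "\<And>n. x n \<in> I (c (Suc n))" "\<And>n. x n \<notin> I (c n)"
      by metis
    have "range x \<subseteq> A"
      using x(1) unfolding I_def by auto
    then obtain N where N: "range x \<subseteq> ideal_gen A (x ` {..<N})"
      using seq_noetherian_self unfolding seq_noetherian_def by meson
    have id: "ideal_of A (I (c N))"
      using c[of N] I_ideal by (auto simp: C_def)
    have "ideal_gen A (x ` {..<N}) \<subseteq> I (c N)"
    proof (rule ideal_gen_least)
      show "x ` {..<N} \<subseteq> I (c N)"
        using x(1) mono[of "Suc _" N] by (fastforce simp: Suc_le_eq)
    qed (use id in \<open>auto simp: ideal_of_def\<close>)
    then show False
      using N x(2)[of N] by blast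
  qed
  then obtain c where c: "c \<in> C" "\<And>d. d \<in> C \<Longrightarrow> I c \<subseteq> I d \<Longrightarrow> I d = I c"
    by blast
  have cA: "c \<in> A" and c1: "1 \<notin> I c"
    using c by (auto simp: C_def)
  have "prime_ideal_of A (I c)"
    unfolding prime_ideal_of_def
  proof (intro conjI ballI impI)
    show "ideal_of A (I c)"
      using I_ideal cA by auto
    show "I c \<noteq> A"
      using c1 one_mem by auto
  next
    fix x y assume xy: "x \<in> A" "y \<in> A" "x * y \<in> I c"
    show "x \<in> I c \<or> y \<in> I c"
    proof (rule disjCI)
      assume "y \<notin> I c"
      \<comment> \<open>Since \<open>y\<close> does not kill the class of \<open>c\<close>, the
        product \<open>c * y\<close> has nonzero class and an annihilator containing
        \<open>I c\<close>. By maximality the two annihilators agree, and \<open>x\<close> lies in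
        that of \<open>c * y\<close>.\<close>
      have "c * y \<in> C"
        unfolding C_def using cA xy \<open>y \<notin> I c\<close> by (auto simp: I_def mult_mem one_mem mult_ac)
      moreover have "I c \<subseteq> I (c * y)"
      proof
        fix w assume "w \<in> I c"
        then obtain s r where *: "w \<in> A" "s \<in> A - p" "r \<in> A" "s * w * c = a * r"
          unfolding I_def by blast
        then have "s * w * (c * y) = a * (r * y)"
          by (metis mult.assoc)
        then show "w \<in> I (c * y)"
          unfolding I_def using * mult_mem[OF \<open>r \<in> A\<close> xy(2)] by blast
      qed
      ultimately have "I (c * y) = I c"
        using c(2) by blast
      moreover have "x \<in> I (c * y)"
        using xy unfolding I_def by (auto simp: mult_ac)
      ultimately show "x \<in> I c"
        by simp
    qed
  qed
  moreover have "a \<in> I c"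
    unfolding I_def using aA cA compl_one by force
  moreover have "I c \<subseteq> p"
  proof
    fix x assume "x \<in> I c"
    then obtain s r where *: "x \<in> A" "s \<in> A - p" "r \<in> A" "s * x * c = a * r"
      unfolding I_def by blast
    show "x \<in> p"
    proof (rule ccontr)
      assume "x \<notin> p"
      then have "s * x \<in> A - p"
        using * compl_mult[of s x] by auto
      then show False
        using c1 * unfolding I_def using one_mem by auto
    qed
  qed
  ultimately have Ip: "I c = p"
    using nonzero_prime_maximal[of "I c" p] a prime_ideal prime_neq unfolding prime_ideal_of_def
    by blast
  have "ideal_of A p"
    using prime_ideal by (simp add: prime_ideal_of_def)
  then obtain F where F: "finite F" "F \<subseteq> p" "p = ideal_gen A F"
    using ideal_fg by meson
  have "\<exists>s. s \<in> A - p \<and> (\<exists>r\<in>A. s * x * c = a * r)" if "x \<in> F" for x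
    using that F Ip unfolding I_def by blast
  then obtain s where s: "\<And>x. x \<in> F \<Longrightarrow> s x \<in> A - p"
    "\<And>x. x \<in> F \<Longrightarrow> \<exists>r\<in>A. s x * x * c = a * r"
    by metis
  define S where "S = prod s F"
  have S: "S \<in> A - p"
    unfolding S_def using compl_prod[OF F(1) s(1)] .
  \<comment> \<open>As \<open>I c = p\<close>, the fraction \<open>c / a\<close> multiplies
    \<open>p\<close> into the localization at \<open>p\<close>; the factor \<open>S\<close> clears
    the denominators for the finitely many generators of \<open>p\<close>. If \<open>u\<close> were
    in \<open>A\<close>, the class of \<open>c\<close> would vanish.\<close>
  define u where "u = S * c / a"
  have "u * x \<in> A" if "x \<in> F" for x
  proof -
    obtain r where r: "r \<in> A" "s x * x * c = a * r"
      using s(2)[OF \<open>x \<in> F\<close>] by blast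
    have "S = s x * prod s (F - {x})"
      unfolding S_def using F that by (simp add: prod.remove)
    then have "S * c * x = prod s (F - {x}) * (s x * x * c)"
      by (simp add: mult_ac)
    then have "u * x = prod s (F - {x}) * r"
      unfolding u_def r using a by (simp add: field_simps)
    then show ?thesis
      using r s(1) by (auto intro!: mult_mem prod_mem)
  qed
  then have "F \<subseteq> {x. u * x \<in> A}"
    by auto
  then have "ideal_gen A F \<subseteq> {x. u * x \<in> A}"
    by (rule ideal_gen_least) (auto simp: distrib_left mult.left_commute intro: add_mem mult_mem zero_mem)
  then have "\<forall>x\<in>p. u * x \<in> A"
    using F by auto
  moreover have "u \<in> frac_field A"
    unfolding u_def frac_field_def using S cA a aA mult_mem by blast
  moreover have "u \<notin> A"
  proof
    assume "u \<in> A"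
    then have "\<exists>r\<in>A. S * 1 * c = a * r"
      using a by (intro bexI[of _ u]) (auto simp: u_def)
    then show False
      using c1 S unfolding I_def using one_mem by blast
  qed
  ultimately show ?thesis
    by blast
qed

text \<open>If \<open>u\<close> mapped \<open>p\<close> into itself, all \<open>a * u ^ n\<close>
  would stay in \<open>p\<close>, and \<open>u\<close> would be integral and hence in
  \<open>A\<close>. So \<open>u\<close> sends some element of \<open>p\<close> to a unit at
  \<open>p\<close>; that element is the uniformizer.\<close>

lemma ex_uniformizer:
  "\<exists>u \<pi>. u \<in> frac_field A \<and> u \<notin> A \<and> (\<forall>x\<in>p. u * x \<in> A) \<and> \<pi> \<in> p \<and> u * \<pi> \<notin> p"
proof -
  obtain u where u: "u \<in> frac_field A" "u \<notin> A" "\<And>x. x \<in> p \<Longrightarrow> u * x \<in> A"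
    using ex_fraction_multiplying_prime_into_ring by blast
  obtain a where a: "a \<in> p" "a \<noteq> 0"
    using prime_zero prime_nonzero by blast
  have "\<exists>\<pi>\<in>p. u * \<pi> \<notin> p"
  proof (rule ccontr)
    assume *: "\<not> ?thesis"
    have "a * u ^ n \<in> p" for n
      using a * by (induction n) (auto simp: mult_ac)
    then have "integral_over A u"
      using integral_if_powers_mem[OF seq_noetherian_self a(2)] prime_subset by blast
    then show False
      using integrally_closed u by blast
  qed
  then show ?thesis
    using u by blast
qed

end

text \<open>The fraction \<open>u\<close> is the inverse of a uniformizer of \<open>A\<close> at \<open>p\<close>.\<close>

locale uniformized_prime = dedekind_prime A p for A p :: "'a::field set" +
  fixes u \<pi> :: 'a
  assumes u_frac: "u \<in> frac_field A"
    and u_not_mem: "u \<notin> A"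
    and u_mult: "x \<in> p \<Longrightarrow> u * x \<in> A"
    and pi_mem: "\<pi> \<in> p"
    and u_pi: "u * \<pi> \<notin> p"
begin

lemma u_pi_compl: "u * \<pi> \<in> A - p"
  using u_mult[OF pi_mem] u_pi by simp

lemma u_nonzero: "u \<noteq> 0"
  using u_not_mem zero_mem by auto

lemma pi_nonzero: "\<pi> \<noteq> 0"
  using u_pi prime_zero by auto

text \<open>Otherwise all \<open>u ^ k * a\<close> would stay in the Noetherian ring
  \<open>A\<close>, which makes \<open>u\<close> integral and so an element of
  \<open>A\<close>.\<close>

lemma ex_power_not_mem:
  assumes "a \<noteq> 0"
  shows "\<exists>k. u ^ k * a \<notin> p"
proof (rule ccontr)
  assume "\<not> ?thesis"
  then have "a * u ^ k \<in> A" for k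
    using prime_subset by (auto simp: mult.commute)
  then have "integral_over A u"
    using integral_if_powers_mem[OF seq_noetherian_self assms] by blast
  then show False
    using integrally_closed u_frac u_not_mem by blast
qed

text \<open>Take the least \<open>k\<close> for which some entry leaves \<open>p\<close>: one step
  earlier all entries lie in \<open>p\<close>, and \<open>u\<close> multiplies \<open>p\<close> into
  \<open>A\<close>. The same \<open>k\<close> serves all entries, so a whole relation can be scaled
  by it.\<close>

lemma primitive_multiple:
  assumes "\<And>i. i \<in> I \<Longrightarrow> c i \<in> A" "j \<in> I" "c j \<noteq> 0"
  shows "\<exists>k. (\<forall>i\<in>I. u ^ k * c i \<in> A) \<and> (\<exists>i\<in>I. u ^ k * c i \<notin> p)"
proof -
  define Q where "Q k \<longleftrightarrow> (\<exists>i\<in>I. u ^ k * c i \<notin> p)" for k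
  define k where "k = (LEAST k. Q k)"
  have "\<exists>k. Q k"
    using ex_power_not_mem[OF assms(3)] assms(2) unfolding Q_def by blast
  then have "Q k"
    unfolding k_def by (rule LeastI_ex)
  moreover have "u ^ k * c i \<in> A" if "i \<in> I" for i
  proof (cases k)
    case 0
    then show ?thesis using assms(1) that by simp
  next
    case (Suc m)
    then have "\<not> Q m"
      unfolding k_def using not_less_Least[of m Q] by simp
    then have "u ^ m * c i \<in> p"
      using that unfolding Q_def by blast
    then show ?thesis
      using u_mult[of "u ^ m * c i"] Suc by (simp add: mult.assoc)
  qed
  ultimately show ?thesis
    unfolding Q_def by blast
qed

text \<open>The case of a single coefficient; \<open>k\<close> is the valuation of \<open>a\<close>
  at \<open>p\<close>.\<close>

lemma uniformizer_decomposition: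
  assumes "a \<in> A" "a \<noteq> 0"
  obtains k where "u ^ k * a \<in> A - p"
  using primitive_multiple[of "{()}" "\<lambda>_. a"] assms by auto

end

section \<open>Simple extensions\<close>

text \<open>Gaussian elimination over the field \<open>R\<close>, by induction on the spanning set:
  a member with nonzero \<open>g\<close>-coefficient is the pivot that removes \<open>g\<close> from
  the others.\<close>

lemma (in subring) ex_linear_dependence:
  assumes inv: "\<And>x. x \<in> R \<Longrightarrow> inverse x \<in> R"
    and "finite G" "finite I" "card G < card I" "\<And>i. i \<in> I \<Longrightarrow> x i \<in> ideal_gen R G"
  shows "\<exists>c. (\<forall>i. c i \<in> R) \<and> (\<exists>i\<in>I. c i \<noteq> 0) \<and> (\<Sum>i\<in>I. c i * x i) = 0"
  using assms(2-)
proof (induction G arbitrary: I x rule: finite_induct)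
  case empty
  then obtain i where "i \<in> I"
    by fastforce
  moreover have "x j = 0" if "j \<in> I" for j
    using empty(3)[OF that] by (simp add: ideal_gen_def)
  ultimately show ?case
    using one_mem by (intro exI[of _ "\<lambda>_. 1"]) auto
next
  case (insert g G)
  have "\<exists>a y. i \<in> I \<longrightarrow> a \<in> R \<and> y \<in> ideal_gen R G \<and> x i = a * g + y" for i
    using ideal_gen_insertE[OF insert(1,2)] insert.prems(3) by metis
  then obtain a y where ay: "\<And>i. i \<in> I \<Longrightarrow> a i \<in> R" "\<And>i. i \<in> I \<Longrightarrow> y i \<in> ideal_gen R G"
    "\<And>i. i \<in> I \<Longrightarrow> x i = a i * g + y i"
    by metis
  show ?case
  proof (cases "\<forall>i\<in>I. a i = 0")
    case True
    have "card G < card I"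
      using insert.prems insert.hyps by simp
    then show ?thesis
      using insert.IH[OF insert.prems(1), of x] True ay by auto
  next
    case False
    then obtain k where k: "k \<in> I" "a k \<noteq> 0"
      by blast
    define q where "q i = a i * inverse (a k)" for i
    have q: "q i \<in> R" if "i \<in> I" for i
      unfolding q_def using that k ay(1) by (intro mult_mem inv) auto
    have "card G < card (I - {k})"
      using insert.prems insert.hyps k by simp
    moreover have "x i - q i * x k \<in> ideal_gen R G" if "i \<in> I - {k}" for i
    proof -
      have "x i - q i * x k = y i - q i * y k"
        using that k by (simp add: ay(3) q_def divide_simps algebra_simps)
      then show ?thesis
        using that k ay(2) q by (auto intro!: ideal_gen_diff ideal_gen_smult)
    qed
    ultimately obtain d where d: "\<And>i. d i \<in> R" "\<exists>i\<in>I - {k}. d i \<noteq> 0"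
      "(\<Sum>i\<in>I - {k}. d i * (x i - q i * x k)) = 0"
      using insert.IH[of "I - {k}" "\<lambda>i. x i - q i * x k"] insert.prems(1) by auto
    \<comment> \<open>The coefficient of the pivot collects the multiples of \<open>x k\<close> that
      were subtracted from the other members.\<close>
    define c where "c i = (if i = k then - (\<Sum>i\<in>I - {k}. d i * q i) else d i)" for i
    have "c i \<in> R" for i
      unfolding c_def using d(1) q by (auto intro!: uminus_mem sum_mem mult_mem)
    moreover have "\<exists>i\<in>I. c i \<noteq> 0"
      using d(2) unfolding c_def by auto
    moreover have "(\<Sum>i\<in>I. c i * x i) = 0"
    proof -
      have "(\<Sum>i\<in>I. c i * x i) = c k * x k + (\<Sum>i\<in>I - {k}. c i * x i)"
        using k insert.prems(1) by (simp add: sum.remove)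
      also have "(\<Sum>i\<in>I - {k}. c i * x i) = (\<Sum>i\<in>I - {k}. d i * x i)"
        by (intro sum.cong) (auto simp: c_def)
      also have "c k * x k + \<dots> = (\<Sum>i\<in>I - {k}. d i * (x i - q i * x k))"
        by (simp add: c_def sum_distrib_left right_diff_distrib sum_subtractf mult_ac)
      finally show ?thesis
        using d(3) by simp
    qed
    ultimately show ?thesis
      by blast
  qed
qed

context subring
begin

lemma frac_fieldI: "a \<in> R \<Longrightarrow> b \<in> R \<Longrightarrow> b \<noteq> 0 \<Longrightarrow> a / b \<in> frac_field R"
  unfolding frac_field_def by blast

lemma subset_frac_field: "R \<subseteq> frac_field R"
  using frac_fieldI[OF _ one_mem] by auto

lemma subring_frac_field: "subring_of (frac_field R)"
  unfolding subring_of_def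
proof (intro conjI ballI)
  show "0 \<in> frac_field R" "1 \<in> frac_field R"
    using subset_frac_field zero_mem one_mem by auto
  fix x y assume "x \<in> frac_field R" "y \<in> frac_field R"
  then obtain a b c d where *: "x = a / b" "y = c / d" "a \<in> R" "b \<in> R" "b \<noteq> 0" "c \<in> R" "d \<in> R" "d \<noteq> 0"
    unfolding frac_field_def by blast
  have "x + y = (a * d + c * b) / (b * d)" "x - y = (a * d - c * b) / (b * d)"
    "x * y = (a * c) / (b * d)"
    using * by (auto simp: add_frac_eq diff_frac_eq)
  moreover have "b * d \<in> R" "b * d \<noteq> 0" "a * d + c * b \<in> R" "a * d - c * b \<in> R" "a * c \<in> R"
    using * by (auto intro!: add_mem diff_mem mult_mem)
  ultimately show "x + y \<in> frac_field R" "x - y \<in> frac_field R" "x * y \<in> frac_field R"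
    by (metis frac_fieldI)+
qed

lemma inverse_frac_field:
  assumes "x \<in> frac_field R"
  shows "inverse x \<in> frac_field R"
proof -
  obtain a b where "x = a / b" "a \<in> R" "b \<in> R" "b \<noteq> 0"
    using assms unfolding frac_field_def by blast
  then show ?thesis
    using frac_fieldI[of b a] frac_fieldI[OF zero_mem one_mem] by (cases "a = 0") auto
qed

lemma common_denominator:
  assumes "finite I" "\<And>i. i \<in> I \<Longrightarrow> c i \<in> frac_field R"
  shows "\<exists>d\<in>R. d \<noteq> 0 \<and> (\<forall>i\<in>I. d * c i \<in> R)"
  using assms
proof (induction I rule: finite_induct)
  case empty
  then show ?case using one_mem one_neq_zero by blast
next
  case (insert i I)
  then obtain d where d: "d \<in> R" "d \<noteq> 0" "\<forall>i\<in>I. d * c i \<in> R"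
    by auto
  obtain a b where ab: "c i = a / b" "a \<in> R" "b \<in> R" "b \<noteq> 0"
    using insert.prems[of i] unfolding frac_field_def by auto
  have "b * d * c j \<in> R" if "j \<in> insert i I" for j
  proof (cases "j = i")
    case True
    then show ?thesis
      using ab d mult_mem by simp
  next
    case False
    then show ?thesis
      using that d ab(3) mult_mem[of b "d * c j"] by (simp add: mult.assoc)
  qed
  then show ?case
    using d ab mult_mem by (intro bexI[of _ "b * d"]) auto
qed

lemma coeff_mult_mem: "(\<And>i. coeff g i \<in> R) \<Longrightarrow> (\<And>i. coeff h i \<in> R) \<Longrightarrow> coeff (g * h) i \<in> R"
  by (auto simp: coeff_mult intro!: sum_mem mult_mem)

lemma coeff_one_mem: "coeff 1 i \<in> R"
  by (auto simp: coeff_1 zero_mem one_mem)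

lemma coeff_power_mem: "(\<And>i. coeff g i \<in> R) \<Longrightarrow> coeff (g ^ n) i \<in> R"
proof (induction n arbitrary: i)
  case 0
  then show ?case using coeff_one_mem by simp
next
  case (Suc n)
  then show ?case unfolding power_Suc by (intro coeff_mult_mem Suc)
qed

lemma subset_simple_ext: "R \<subseteq> simple_ext R \<theta>"
proof
  fix a assume "a \<in> R"
  then have "a = poly [:a:] \<theta> / poly 1 \<theta>" "\<forall>i. coeff [:a:] i \<in> R" "\<forall>i. coeff 1 i \<in> R" "poly 1 \<theta> \<noteq> 0"
    by (auto simp: coeff_pCons coeff_one_mem zero_mem simp del: coeff_1 split: nat.splits)
  then show "a \<in> simple_ext R \<theta>"
    unfolding simple_ext_def by blast
qed

lemma subring_simple_ext: "subring_of (simple_ext R \<theta>)"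
  unfolding subring_of_def
proof (intro conjI ballI)
  show "0 \<in> simple_ext R \<theta>" "1 \<in> simple_ext R \<theta>"
    using subset_simple_ext zero_mem one_mem by auto
  fix x y assume "x \<in> simple_ext R \<theta>" "y \<in> simple_ext R \<theta>"
  then obtain a b c d where *: "x = poly a \<theta> / poly b \<theta>" "y = poly c \<theta> / poly d \<theta>"
    "\<And>i. coeff a i \<in> R" "\<And>i. coeff b i \<in> R" "poly b \<theta> \<noteq> 0"
    "\<And>i. coeff c i \<in> R" "\<And>i. coeff d i \<in> R" "poly d \<theta> \<noteq> 0"
    unfolding simple_ext_def by blast
  have "x + y = poly (a * d + c * b) \<theta> / poly (b * d) \<theta>"
    "x - y = poly (a * d - c * b) \<theta> / poly (b * d) \<theta>"
    "x * y = poly (a * c) \<theta> / poly (b * d) \<theta>"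
    using * by (auto simp: add_frac_eq diff_frac_eq)
  moreover have "poly (b * d) \<theta> \<noteq> 0" "\<forall>i. coeff (b * d) i \<in> R"
    "\<forall>i. coeff (a * d + c * b) i \<in> R" "\<forall>i. coeff (a * d - c * b) i \<in> R" "\<forall>i. coeff (a * c) i \<in> R"
    using * by (simp_all add: coeff_mult_mem add_mem diff_mem)
  ultimately show "x + y \<in> simple_ext R \<theta>" "x - y \<in> simple_ext R \<theta>" "x * y \<in> simple_ext R \<theta>"
    unfolding simple_ext_def by blast+
qed

lemma inverse_simple_ext:
  assumes "x \<in> simple_ext R \<theta>"
  shows "inverse x \<in> simple_ext R \<theta>"
proof (cases "x = 0")
  case True
  then show ?thesis using assms by simp
next
  case False
  obtain a b where *: "x = poly a \<theta> / poly b \<theta>" "\<forall>i. coeff a i \<in> R" "\<forall>i. coeff b i \<in> R"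
    "poly b \<theta> \<noteq> 0"
    using assms unfolding simple_ext_def by blast
  then have "inverse x = poly b \<theta> / poly a \<theta>" "poly a \<theta> \<noteq> 0"
    using False by auto
  then show ?thesis
    using * unfolding simple_ext_def by blast
qed

text \<open>The monic relation makes the span of the powers below \<open>degree f\<close> stable
  under multiplication by \<open>\<theta>\<close>, so evaluating \<open>g\<close> coefficient by
  coefficient never leaves it.\<close>

lemma poly_mem_span_powers:
  assumes "lead_coeff f = 1" "\<And>i. coeff f i \<in> R" "poly f \<theta> = 0" "\<And>i. coeff g i \<in> R"
  shows "poly g \<theta> \<in> ideal_gen R ((\<lambda>i. \<theta> ^ i) ` {..<degree f})"
proof -
  define S where "S = ideal_gen R ((\<lambda>i. \<theta> ^ i) ` {..<degree f})"
  have base: "\<theta> ^ i \<in> S" if "i < degree f" for i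
    unfolding S_def using that by (intro ideal_gen_base) auto
  have "(\<Sum>i<degree f. coeff f i * \<theta> ^ i) + \<theta> ^ degree f = 0"
    using assms(1,3) unfolding poly_altdef by (simp add: lessThan_Suc_atMost[symmetric])
  then have "\<theta> ^ degree f = (\<Sum>i<degree f. - coeff f i * \<theta> ^ i)"
    by (simp add: sum_negf eq_neg_iff_add_eq_0 add.commute)
  also have "\<dots> \<in> S"
    unfolding S_def using base[unfolded S_def] assms(2)
    by (intro ideal_gen_sum ideal_gen_smult uminus_mem) auto
  finally have top: "\<theta> ^ degree f \<in> S" .
  have step: "\<theta> * y \<in> S" if "y \<in> S" for y
    unfolding S_def
  proof (rule ideal_gen_stable[OF _ that[unfolded S_def]])
    fix g assume "g \<in> (\<lambda>i. \<theta> ^ i) ` {..<degree f}"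
    then obtain i where i: "i < degree f" "g = \<theta> ^ i"
      by auto
    have "\<theta> ^ Suc i \<in> S"
      using i base[of "Suc i"] top by (cases "Suc i = degree f") auto
    then show "\<theta> * g \<in> ideal_gen R ((\<lambda>i. \<theta> ^ i) ` {..<degree f})"
      unfolding S_def i(2) by simp
  qed
  have "degree f > 0"
    using assms(1,3) by (cases "degree f = 0") (auto simp: poly_altdef)
  then have one: "1 \<in> S"
    using base[of 0] by simp
  show ?thesis
    unfolding S_def[symmetric] using assms(4)
  proof (induction g)
    case 0
    then show ?case by (simp add: S_def ideal_gen_zero)
  next
    case (pCons a g)
    have g: "coeff g i \<in> R" for i
      using pCons.prems[of "Suc i"] by simp
    have "a \<in> R"
      using pCons.prems[of 0] by simp
    then have "a * 1 \<in> S"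
      unfolding S_def using one by (intro ideal_gen_smult) (simp_all add: S_def)
    then have "a * 1 + \<theta> * poly g \<theta> \<in> S"
      using step[OF pCons.IH[OF g]] unfolding S_def by (rule ideal_gen_add)
    then show ?case
      by simp
  qed
qed

text \<open>Up to a common nonzero factor, the \<open>degree f + 1\<close> powers of
  \<open>z\<close> lie in the span of at most \<open>degree f\<close> elements. What matters later
  is that this degree bound is the same for all \<open>z\<close>.\<close>

lemma simple_ext_algebraic:
  assumes "lead_coeff f = 1" "\<And>i. coeff f i \<in> R" "poly f \<theta> = 0"
    and inv: "\<And>x. x \<in> R \<Longrightarrow> inverse x \<in> R"
    and z: "z \<in> simple_ext R \<theta>"
  shows "\<exists>c. (\<forall>i. c i \<in> R) \<and> (\<exists>i\<le>degree f. c i \<noteq> 0) \<and> (\<Sum>i\<le>degree f. c i * z ^ i) = 0"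
proof -
  obtain a b where *: "z = poly a \<theta> / poly b \<theta>" "\<And>i. coeff a i \<in> R" "\<And>i. coeff b i \<in> R"
    "poly b \<theta> \<noteq> 0"
    using z unfolding simple_ext_def by blast
  define n where "n = degree f"
  \<comment> \<open>Homogenizing clears denominators: \<open>x i\<close> is \<open>z ^ i\<close>
    times the common factor \<open>poly b \<theta> ^ n\<close>, and it is the value of a
    polynomial.\<close>
  define x where "x i = poly (a ^ i * b ^ (n - i)) \<theta>" for i
  have "x i \<in> ideal_gen R ((\<lambda>i. \<theta> ^ i) ` {..<degree f})" for i
    unfolding x_def
    by (rule poly_mem_span_powers[OF assms(1-3)])
      (intro coeff_mult_mem coeff_power_mem *(2,3))
  moreover have "card ((\<lambda>i. \<theta> ^ i) ` {..<degree f}) < card {..n}"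
    using card_image_le[of "{..<degree f}" "\<lambda>i. \<theta> ^ i"] by (simp add: n_def)
  ultimately obtain c where c: "\<And>i. c i \<in> R" "\<exists>i\<in>{..n}. c i \<noteq> 0" "(\<Sum>i\<le>n. c i * x i) = 0"
    using ex_linear_dependence[OF inv, of "(\<lambda>i. \<theta> ^ i) ` {..<degree f}" "{..n}" x] by auto
  have "x i = poly b \<theta> ^ n * z ^ i" if "i \<le> n" for i
    using that *(4) unfolding x_def *(1) by (simp add: power_divide power_diff)
  then have "poly b \<theta> ^ n * (\<Sum>i\<le>n. c i * z ^ i) = 0"
    using c(3) by (simp add: sum_distrib_left mult_ac)
  then show ?thesis
    using c * by (auto simp: n_def)
qed

end

section \<open>Valuations at locally principal primes\<close>

text \<open>\<open>decomposition\<close> says, with fractions cleared, that every nonzero element is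
  a power of \<open>t\<close> times a unit of the local ring at \<open>P\<close>, which is thus a
  discrete valuation ring. \<open>comaximal\<close> says that \<open>P\<close> is a maximal ideal;
  it is what identifies the powers of \<open>P\<close> in \<open>ideal_pow_eq\<close>.\<close>

locale discrete_prime = prime_subring R P for R P :: "'a::field set" +
  fixes t :: 'a
  assumes t_mem: "t \<in> P"
    and t_nonzero: "t \<noteq> 0"
    and comaximal: "a \<in> R - P \<Longrightarrow> \<exists>b\<in>R. a * b - 1 \<in> P"
    and decomposition: "a \<in> R \<Longrightarrow> a \<noteq> 0 \<Longrightarrow> \<exists>k. \<exists>b\<in>R - P. \<exists>c\<in>R - P. b * a = t ^ k * c"
begin

lemma t_mem_R: "t \<in> R"
  using t_mem prime_subset by blast

text \<open>The right side is the \<open>n\<close>-th symbolic power of \<open>P\<close>, the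
  elements of \<open>R\<close> that \<open>t ^ n\<close> divides in the local ring. Powers of a
  maximal ideal agree with its symbolic powers, because a denominator outside \<open>P\<close> is
  invertible modulo \<open>P\<close>.\<close>

lemma ideal_pow_eq: "ideal_pow R P n = {x \<in> R. \<exists>d\<in>R - P. \<exists>c\<in>R. d * x = t ^ n * c}"
proof (induction n)
  case 0
  show ?case
    using compl_one by fastforce
next
  case (Suc n)
  define T where "T n = {x \<in> R. \<exists>d\<in>R - P. \<exists>c\<in>R. d * x = t ^ n * c}" for n
  have T_add: "x + y \<in> T m" if xy: "x \<in> T m" "y \<in> T m" for x y m
  proof -
    obtain d c d' c' where *: "x \<in> R" "y \<in> R" "d \<in> R - P" "c \<in> R" "d * x = t ^ m * c"
      "d' \<in> R - P" "c' \<in> R" "d' * y = t ^ m * c'"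
      using xy unfolding T_def by blast
    have "d * d' * (x + y) = d' * (d * x) + d * (d' * y)"
      by (simp add: algebra_simps)
    then have "d * d' * (x + y) = t ^ m * (d' * c + d * c')"
      unfolding * by (simp add: algebra_simps)
    moreover have "d * d' \<in> R - P" "d' * c + d * c' \<in> R" "x + y \<in> R"
      using * compl_mult[of d d'] by (auto intro: add_mem mult_mem)
    ultimately show ?thesis
      unfolding T_def by blast
  qed
  have T_zero: "0 \<in> T m" for m
    unfolding T_def using zero_mem compl_one by auto
  have T_mult: "a * b \<in> T (Suc n)" if a: "a \<in> T n" and b: "b \<in> P" for a b
  proof (cases "b = 0")
    case True
    then show ?thesis using T_zero by simp
  next
    case False
    have bR: "b \<in> R"
      using b prime_subset by auto
    obtain j d e where j: "d \<in> R - P" "e \<in> R - P" "d * b = t ^ j * e"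
      using decomposition[OF bR False] by blast
    \<comment> \<open>This excludes the exponent 0, as \<open>e\<close> lies outside
      \<open>P\<close>, so a factor \<open>t\<close> can be split off.\<close>
    have "d * b \<in> P"
      using prime_smult[OF _ b] j(1) by blast
    then obtain i where i: "j = Suc i"
      using j by (cases j) auto
    obtain d' c where c: "a \<in> R" "d' \<in> R - P" "c \<in> R" "d' * a = t ^ n * c"
      using a unfolding T_def by blast
    have "d * d' * (a * b) = (d' * a) * (d * b)"
      by (simp add: mult_ac)
    then have "d * d' * (a * b) = t ^ Suc n * (t ^ i * e * c)"
      unfolding c j i by (simp add: mult_ac)
    moreover have "d * d' \<in> R - P" "t ^ i * e * c \<in> R" "a * b \<in> R"
      using c j bR t_mem_R compl_mult[of d d'] by (auto intro!: mult_mem power_mem)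
    ultimately show ?thesis
      unfolding T_def by blast
  qed
  have IH: "ideal_pow R P n = T n"
    using Suc unfolding T_def .
  have "ideal_pow R P (Suc n) = ideal_mult (T n) P"
    using IH by simp
  also have "\<dots> = T (Suc n)"
  proof (intro equalityI subsetI)
    fix x assume "x \<in> ideal_mult (T n) P"
    then obtain m :: nat and a b where x: "x = (\<Sum>k<m. a k * b k)" "\<forall>k<m. a k \<in> T n \<and> b k \<in> P"
      unfolding ideal_mult_def by blast
    have "(\<Sum>k\<in>I. a k * b k) \<in> T (Suc n)" if "finite I" "I \<subseteq> {..<m}" for I
      using that by (induction I rule: finite_induct) (auto intro!: T_zero T_add T_mult simp: x)
    then show "x \<in> T (Suc n)"
      unfolding x by blast
  next
    fix x assume "x \<in> T (Suc n)"
    then obtain d c where dc: "x \<in> R" "d \<in> R - P" "c \<in> R" "d * x = t ^ Suc n * c"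
      unfolding T_def by blast
    obtain e where e: "e \<in> R" "d * e - 1 \<in> P"
      using comaximal[OF dc(2)] by blast
    \<comment> \<open>In \<open>x = e * (d * x) + x * q\<close> the first summand is
      \<open>t ^ n * (c * e)\<close> times \<open>t\<close>, and the second is an element of the
      \<open>n\<close>-th power times an element of \<open>P\<close>.\<close>
    define q where "q = 1 - d * e"
    have q: "q \<in> P"
      using prime_diff[OF prime_zero e(2)] by (simp add: q_def)
    have "x = e * (d * x) + x * q"
      by (simp add: q_def algebra_simps)
    then have x_eq: "x = (t ^ n * (c * e)) * t + x * q"
      unfolding dc(4) by (simp add: mult_ac)
    have ce: "c * e \<in> R" "t ^ n * (c * e) \<in> R"
      using dc e t_mem_R by (auto intro!: mult_mem power_mem)
    then have "t ^ n * (c * e) \<in> T n"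
      unfolding T_def using compl_one mult_1 by blast
    moreover have "x \<in> T n"
    proof -
      have "d * x = t ^ n * (t * c)" "t * c \<in> R"
        using dc t_mem_R by (auto intro: mult_mem)
      then show ?thesis
        unfolding T_def using dc by blast
    qed
    moreover have "x = (\<Sum>k<(2::nat). (if k = 0 then t ^ n * (c * e) else x) * (if k = 0 then t else q))"
      using x_eq by (simp add: numeral_2_eq_2)
    ultimately show "x \<in> ideal_mult (T n) P"
      unfolding ideal_mult_def using t_mem q
      by (intro CollectI exI[of _ "2::nat"] exI[of _ "\<lambda>k. if k = 0 then t ^ n * (c * e) else x"]
          exI[of _ "\<lambda>k. if k = 0 then t else q"]) auto
  qed
  finally show ?case
    unfolding T_def .
qed

text \<open>For \<open>n > k\<close>, cancelling \<open>t ^ k\<close> would exhibit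
  \<open>d * c\<close>, a product of two elements outside \<open>P\<close>, as a multiple of
  \<open>t\<close>.\<close>

lemma mem_ideal_pow_iff:
  assumes "a \<in> R" "b \<in> R - P" "c \<in> R - P" "b * a = t ^ k * c"
  shows "a \<in> ideal_pow R P n \<longleftrightarrow> n \<le> k"
proof
  assume "n \<le> k"
  then have "b * a = t ^ n * (t ^ (k - n) * c)"
    using assms by (simp add: mult.assoc[symmetric] power_add[symmetric])
  moreover have "t ^ (k - n) * c \<in> R"
    using assms t_mem_R by (auto intro: mult_mem power_mem)
  ultimately show "a \<in> ideal_pow R P n"
    unfolding ideal_pow_eq using assms by blast
next
  assume "a \<in> ideal_pow R P n"
  then obtain d e where de: "d \<in> R - P" "e \<in> R" "d * a = t ^ n * e"
    unfolding ideal_pow_eq by blast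
  show "n \<le> k"
  proof (rule ccontr)
    assume "\<not> n \<le> k"
    then obtain i where i: "n = k + Suc i"
      using less_imp_Suc_add[of k n] by auto
    have "t ^ k * (d * c) = d * (b * a)"
      unfolding assms(4) by (simp add: mult_ac)
    also have "\<dots> = b * (d * a)"
      by (simp add: mult_ac)
    also have "\<dots> = t ^ k * (t * (t ^ i * (b * e)))"
      unfolding de i by (simp add: power_add mult_ac)
    finally have "d * c = t * (t ^ i * (b * e))"
      using t_nonzero by simp
    moreover have "t * (t ^ i * (b * e)) \<in> P"
      using assms de t_mem_R t_mem by (auto intro!: prime_smult2 mult_mem power_mem)
    ultimately show False
      using compl_mult[of d c] de assms by auto
  qed
qed

lemma val_O_eq:
  assumes "a \<in> R" "b \<in> R - P" "c \<in> R - P" "b * a = t ^ k * c"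
  shows "val_O R P a = k"
  unfolding val_O_def mem_ideal_pow_iff[OF assms] by (rule Greatest_equality) auto

section \<open>The valuation on the fraction field\<close>

definition local_unit :: "'a \<Rightarrow> bool" where
  "local_unit x \<longleftrightarrow> (\<exists>a\<in>R - P. \<exists>b\<in>R - P. x = a / b)"

lemma local_unit_mult: "local_unit x \<Longrightarrow> local_unit y \<Longrightarrow> local_unit (x * y)"
  unfolding local_unit_def by (metis compl_mult times_divide_times_eq)

lemma local_unit_inverse: "local_unit x \<Longrightarrow> local_unit (inverse x)"
  unfolding local_unit_def by (metis inverse_divide)

lemma local_unit_compl: "a \<in> R - P \<Longrightarrow> local_unit a"
  unfolding local_unit_def using compl_one by (metis div_by_1)

lemma local_unit_nonzero: "local_unit x \<Longrightarrow> x \<noteq> 0"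
  unfolding local_unit_def using compl_nonzero by auto

text \<open>A positive power of \<open>t\<close> equal to a unit \<open>a / b\<close> would put
  \<open>a\<close> into \<open>P\<close>; inversion reduces negative exponents to this case.\<close>

lemma local_unit_power_iff: "local_unit (t powi k) \<longleftrightarrow> k = 0"
proof
  have pos: "k \<le> 0" if k: "local_unit (t powi k)" for k
  proof (rule ccontr)
    assume "\<not> k \<le> 0"
    then have "k = int (Suc (nat (k - 1)))"
      by simp
    then obtain m where m: "k = int (Suc m)"
      by blast
    obtain a b where ab: "a \<in> R - P" "b \<in> R - P" "t powi k = a / b"
      using k unfolding local_unit_def by blast
    have "t ^ Suc m = a / b"
      using ab(3) unfolding m power_int_of_nat .
    then have "a = t * (t ^ m * b)"
      using compl_nonzero[OF ab(2)] by (simp add: field_simps)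
    moreover have "t * (t ^ m * b) \<in> P"
      using t_mem t_mem_R ab by (auto intro!: prime_smult2 mult_mem power_mem)
    ultimately show False
      using ab by auto
  qed
  assume "local_unit (t powi k)"
  then show "k = 0"
    using pos[of k] pos[of "- k"] local_unit_inverse[of "t powi k"] by (auto simp: power_int_minus)
next
  assume "k = 0"
  then show "local_unit (t powi k)"
    using local_unit_compl[OF compl_one] by simp
qed

lemma power_unit_unique:
  assumes "t powi k * x = t powi l * y" "local_unit x" "local_unit y"
  shows "k = l"
proof -
  have "t powi (k - l) = y * inverse x"
    using assms local_unit_nonzero t_nonzero by (auto simp: power_int_diff field_simps)
  then have "local_unit (t powi (k - l))"
    using assms local_unit_mult local_unit_inverse by simp
  then show ?thesis
    by (simp add: local_unit_power_iff)
qed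

lemma mem_decomposition:
  assumes "a \<in> R" "a \<noteq> 0"
  shows "\<exists>x. local_unit x \<and> a = t powi int (val_O R P a) * x"
proof -
  obtain k b c where *: "b \<in> R - P" "c \<in> R - P" "b * a = t ^ k * c"
    using decomposition[OF assms] by blast
  then have "a = t powi int (val_O R P a) * (c / b)"
    using compl_nonzero[of b] val_O_eq[OF assms(1) *] by (auto simp: field_simps)
  moreover have "local_unit (c / b)"
    using * unfolding local_unit_def by blast
  ultimately show ?thesis
    by blast
qed

lemma fraction_decomposition:
  assumes "a \<in> R" "b \<in> R" "a \<noteq> 0" "b \<noteq> 0"
  shows "\<exists>x. local_unit x \<and> a / b = t powi (int (val_O R P a) - int (val_O R P b)) * x"
proof -
  define m n where "m = int (val_O R P a)" and "n = int (val_O R P b)"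
  obtain x y where *: "local_unit x" "a = t powi m * x" "local_unit y" "b = t powi n * y"
    using mem_decomposition assms unfolding m_def n_def by metis
  have "a / b = t powi (m - n) * (x * inverse y)"
    unfolding *(2,4) by (simp add: power_int_diff t_nonzero divide_inverse mult_ac)
  moreover have "local_unit (x * inverse y)"
    using * by (intro local_unit_mult local_unit_inverse)
  ultimately show ?thesis
    unfolding m_def n_def by blast
qed

text \<open>\<open>val_L\<close> is a definite description over all fractions representing
  \<open>x\<close>. Each of them writes \<open>x\<close> as a power of \<open>t\<close> times a
  local unit, and the exponent is unique, so the description denotes that exponent.\<close>

lemma ex_val_decomposition:
  assumes "x \<in> frac_field R" "x \<noteq> 0"
  shows "\<exists>y. local_unit y \<and> x = t powi val_L R P x * y"
proof -
  obtain a b where ab: "x = a / b" "a \<in> R" "b \<in> R" "b \<noteq> 0" "a \<noteq> 0"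
    using assms unfolding frac_field_def by auto
  obtain y where y: "local_unit y" "x = t powi (int (val_O R P a) - int (val_O R P b)) * y"
    using fraction_decomposition ab by metis
  have "val_L R P x = int (val_O R P a) - int (val_O R P b)"
    unfolding val_L_def
  proof (rule the_equality)
    show "\<exists>a'\<in>R. \<exists>b'\<in>R. a' \<noteq> 0 \<and> b' \<noteq> 0 \<and> x = a' / b' \<and>
      int (val_O R P a) - int (val_O R P b) = int (val_O R P a') - int (val_O R P b')"
      using ab by blast
  next
    fix k
    assume "\<exists>a'\<in>R. \<exists>b'\<in>R. a' \<noteq> 0 \<and> b' \<noteq> 0 \<and> x = a' / b' \<and>
      k = int (val_O R P a') - int (val_O R P b')"
    then obtain z where "local_unit z" "x = t powi k * z"
      using fraction_decomposition by metis
    then show "k = int (val_O R P a) - int (val_O R P b)"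
      using power_unit_unique y by metis
  qed
  then show ?thesis
    using y by metis
qed

lemma val_L_eqI:
  assumes "x \<in> frac_field R" "local_unit y" "x = t powi k * y"
  shows "val_L R P x = k"
proof -
  have "x \<noteq> 0"
    using assms t_nonzero local_unit_nonzero by auto
  then show ?thesis
    using ex_val_decomposition[OF assms(1)] assms(2,3) power_unit_unique by metis
qed

lemma frac_mult: "x \<in> frac_field R \<Longrightarrow> y \<in> frac_field R \<Longrightarrow> x * y \<in> frac_field R"
  using subring.mult_mem[OF subring.intro[OF subring_frac_field]] .

lemma frac_add: "x \<in> frac_field R \<Longrightarrow> y \<in> frac_field R \<Longrightarrow> x + y \<in> frac_field R"
  using subring.add_mem[OF subring.intro[OF subring_frac_field]] .

lemma val_L_mult:
  assumes "x \<in> frac_field R" "y \<in> frac_field R" "x \<noteq> 0" "y \<noteq> 0"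
  shows "val_L R P (x * y) = val_L R P x + val_L R P y"
proof -
  obtain a b where *: "local_unit a" "x = t powi val_L R P x * a"
    "local_unit b" "y = t powi val_L R P y * b"
    using ex_val_decomposition assms by metis
  have "x * y = t powi (val_L R P x + val_L R P y) * (a * b)"
    by (subst *(2), subst *(4)) (simp add: power_int_add t_nonzero mult_ac)
  then show ?thesis
    using val_L_eqI[OF frac_mult[OF assms(1,2)] local_unit_mult] * by metis
qed

lemma val_L_unit: "a \<in> R - P \<Longrightarrow> val_L R P a = 0"
  using val_L_eqI[of a a 0] local_unit_compl[of a] subset_frac_field by auto

lemma val_L_uminus:
  assumes "x \<in> frac_field R" "x \<noteq> 0"
  shows "val_L R P (- x) = val_L R P x"
proof -
  have "- 1 \<notin> P"
    using prime_diff[OF prime_zero, of "- 1"] one_not_prime by auto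
  then have "- 1 \<in> R - P"
    using uminus_mem[OF one_mem] by simp
  then show ?thesis
    using val_L_mult[of "- 1" x] val_L_unit[of "- 1"] subset_frac_field assms by auto
qed

text \<open>After the smaller power of \<open>t\<close> is factored out, the cofactor is an element
  of \<open>R\<close> divided by one outside \<open>P\<close>, so it contributes a nonnegative
  exponent.\<close>

lemma val_L_add:
  assumes "x \<in> frac_field R" "y \<in> frac_field R" "x \<noteq> 0" "y \<noteq> 0" "x + y \<noteq> 0"
  shows "val_L R P (x + y) \<ge> min (val_L R P x) (val_L R P y)"
proof -
  have le: "val_L R P (x + y) \<ge> val_L R P x"
    if xy: "x \<in> frac_field R" "y \<in> frac_field R" "x \<noteq> 0" "y \<noteq> 0" "x + y \<noteq> 0"
      "val_L R P x \<le> val_L R P y" for x y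
  proof -
    obtain a b where *: "local_unit a" "x = t powi val_L R P x * a"
      "local_unit b" "y = t powi val_L R P y * b"
      using ex_val_decomposition xy by metis
    obtain c d c' d' where cd: "c \<in> R - P" "d \<in> R - P" "a = c / d"
      "c' \<in> R - P" "d' \<in> R - P" "b = c' / d'"
      using * unfolding local_unit_def by blast
    have nz: "d \<noteq> 0" "d' \<noteq> 0"
      using cd compl_nonzero by auto
    define k where "k = val_L R P x"
    obtain m where m: "val_L R P y = k + int m"
      using xy(6) zle_iff_zadd unfolding k_def by blast
    define e where "e = c * d' + t ^ m * (c' * d)"
    have "x + y = t powi k * (a + t ^ m * b)"
      by (subst *(2), subst *(4)) (simp add: m k_def[symmetric] power_int_add t_nonzero algebra_simps)
    also have "a + t ^ m * b = e * inverse (d * d')"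
      unfolding cd e_def using nz by (simp add: field_simps)
    finally have sum: "x + y = t powi k * (e * inverse (d * d'))" .
    have e: "e \<in> R" "e \<noteq> 0"
      using cd t_mem_R sum xy(5) unfolding e_def by (auto intro!: add_mem mult_mem power_mem)
    obtain z where z: "local_unit z" "e = t powi int (val_O R P e) * z"
      using mem_decomposition[OF e] by blast
    have "x + y = t powi (k + int (val_O R P e)) * (z * inverse (d * d'))"
      unfolding sum by (subst z(2)) (simp add: power_int_add t_nonzero mult_ac)
    moreover have "local_unit (z * inverse (d * d'))"
      using local_unit_mult[OF z(1) local_unit_inverse[OF local_unit_compl[OF compl_mult[OF cd(2,5)]]]] .
    ultimately have "val_L R P (x + y) = k + int (val_O R P e)"
      using val_L_eqI[OF frac_add[OF xy(1,2)]] by blast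
    then show ?thesis
      unfolding k_def by simp
  qed
  show ?thesis
    using le[of x y] le[of y x] assms by (cases "val_L R P x \<le> val_L R P y") (auto simp: add.commute)
qed

end

section \<open>Primes of the integral closure\<close>

text \<open>The field \<open>L\<close> enters through a degree bound \<open>n\<close> valid for all
  its elements at once; this uniformity is what bounds exponents in
  \<open>power_bound\<close>.\<close>

locale dedekind_extension = uniformized_prime A p u \<pi> for A p :: "'a::field set" and u \<pi> +
  fixes L :: "'a set" and n :: nat
  assumes subring_L: "subring_of L"
    and inverse_L: "z \<in> L \<Longrightarrow> inverse z \<in> L"
    and A_subset_L: "A \<subseteq> L"
    and algebraic: "z \<in> L \<Longrightarrow>
      \<exists>c. (\<forall>i\<le>n. c i \<in> A) \<and> (\<exists>i\<le>n. c i \<noteq> 0) \<and> (\<Sum>i\<le>n. c i * z ^ i) = 0"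
begin

sublocale L: subring L
  using subring_L by unfold_locales

lemma subring_int_closure: "subring_of (int_closure A L)"
  unfolding subring_of_def int_closure_def
  using L.zero_mem L.one_mem zero_mem one_mem
  by (auto intro: L.add_mem L.diff_mem L.mult_mem integral_ring_ops integral_self)

lemma subset_int_closure: "A \<subseteq> int_closure A L"
  using A_subset_L integral_self unfolding int_closure_def by auto

text \<open>The relation is scaled by the power of \<open>u\<close> at which one of its coefficients
  first leaves \<open>p\<close>.\<close>

lemma primitive_relation:
  assumes "z \<in> L"
  shows "\<exists>c. (\<forall>i\<le>n. c i \<in> A) \<and> (\<exists>i\<le>n. c i \<notin> p) \<and> (\<Sum>i\<le>n. c i * z ^ i) = 0"
proof -
  obtain c j where c: "\<forall>i\<le>n. c i \<in> A" "j \<le> n" "c j \<noteq> 0" "(\<Sum>i\<le>n. c i * z ^ i) = 0"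
    using algebraic[OF assms] by blast
  obtain k where "\<forall>i\<le>n. u ^ k * c i \<in> A" "\<exists>i\<le>n. u ^ k * c i \<notin> p"
    using primitive_multiple[of "{..n}" c j] c by auto
  moreover have "(\<Sum>i\<le>n. u ^ k * c i * z ^ i) = u ^ k * (\<Sum>i\<le>n. c i * z ^ i)"
    by (simp add: sum_distrib_left mult.assoc)
  ultimately show ?thesis
    using c(4) by (intro exI[of _ "\<lambda>i. u ^ k * c i"]) simp
qed

text \<open>The partial Horner sums of a relation for \<open>z\<close> map the span of
  \<open>1, z, \<dots>, z ^ (n - 1)\<close> to itself.\<close>

lemma integral_horner_sum:
  assumes c: "\<And>i. i \<le> n \<Longrightarrow> c i \<in> A" and rel: "(\<Sum>i\<le>n. c i * z ^ i) = 0"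
    and z: "z \<in> L" and n: "n > 0" and i: "i \<le> Suc n"
  shows "(\<Sum>l=i..n. c l * z ^ (l - i)) \<in> int_closure A L"
proof -
  define b where "b = (\<Sum>l=i..n. c l * z ^ (l - i))"
  define M where "M = ideal_gen A ((\<lambda>i. z ^ i) ` {..<n})"
  have base: "z ^ j \<in> M" if "j < n" for j
    unfolding M_def using that by (intro ideal_gen_base) auto
  have "b * z ^ j \<in> M" if j: "j < n" for j
  proof (cases "j < i")
    case True
    \<comment> \<open>For \<open>j < i\<close> every exponent \<open>l - i + j\<close> is already
      below \<open>n\<close>.\<close>
    have "b * z ^ j = (\<Sum>l=i..n. c l * z ^ (l - i + j))"
      unfolding b_def sum_distrib_right power_add mult.assoc ..
    also have "\<dots> \<in> M"
      unfolding M_def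
      by (intro ideal_gen_sum ideal_gen_smult base[unfolded M_def] c) (use True in auto)
    finally show ?thesis .
  next
    case False
    have "(\<Sum>l\<le>n. c l * z ^ l) = (\<Sum>l<i. c l * z ^ l) + (\<Sum>l=i..n. c l * z ^ l)"
    proof -
      have "{..n} = {..<i} \<union> {i..n}"
        using False j by auto
      then show ?thesis
        by (simp add: sum.union_disjoint ivl_disj_int)
    qed
    moreover have "(\<Sum>l=i..n. c l * z ^ l) = b * z ^ i"
      unfolding b_def sum_distrib_right
      by (intro sum.cong) (auto simp: mult.assoc power_add[symmetric])
    \<comment> \<open>The relation trades the upper part of the sum for the lower part, where
      \<open>l < i\<close> keeps the exponents \<open>l + (j - i)\<close> below
      \<open>n\<close>.\<close>
    ultimately have bz: "b * z ^ i = - (\<Sum>l<i. c l * z ^ l)"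
      using rel by (simp add: eq_neg_iff_add_eq_0 add.commute)
    have "b * z ^ j = (b * z ^ i) * z ^ (j - i)"
      using False by (simp add: mult.assoc power_add[symmetric])
    also have "\<dots> = (\<Sum>l<i. (- c l) * z ^ (l + (j - i)))"
      unfolding bz by (simp add: sum_distrib_right sum_negf mult.assoc power_add)
    also have "\<dots> \<in> M"
      unfolding M_def
      by (intro ideal_gen_sum ideal_gen_smult base[unfolded M_def] uminus_mem c)
        (use False j in auto)
    finally show ?thesis .
  qed
  then have "b * m \<in> M" if "m \<in> M" for m
    using ideal_gen_stable[of "(\<lambda>i. z ^ i) ` {..<n}" b m] that unfolding M_def by auto
  moreover have "1 \<in> M"
    using base[of 0] n by simp
  ultimately have "integral_over A b"
    unfolding M_def using integral_if_stable[of "(\<lambda>i. z ^ i) ` {..<n}" b] by blast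
  moreover have "b \<in> L"
    unfolding b_def using z c A_subset_L by (intro L.sum_mem L.mult_mem L.power_mem) auto
  ultimately show ?thesis
    unfolding b_def[symmetric] int_closure_def by simp
qed

end

locale prime_above = dedekind_extension A p u \<pi> L n
  for A p :: "'a::field set" and u \<pi> L n +
  fixes P :: "'a set"
  assumes prime_P: "prime_ideal_of (int_closure A L) P"
    and P_over_p: "P \<inter> A = p"
begin

sublocale O: prime_subring "int_closure A L" P
  using subring_int_closure prime_P by unfold_locales

sublocale V: subring O.loc
  using O.subring_loc by unfold_locales

lemma A_subset_V: "A \<subseteq> O.loc"
  using subset_int_closure O.subset_loc by blast

lemma compl_p_subset: "a \<in> A - p \<Longrightarrow> a \<in> int_closure A L - P"
  using subset_int_closure P_over_p by blast

lemma p_subset_P: "p \<subseteq> P"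
  using P_over_p by blast

lemma loc_max_Int_A: "a \<in> O.loc_max \<Longrightarrow> a \<in> A \<Longrightarrow> a \<in> p"
  using O.loc_max_Int[of a] subset_int_closure P_over_p by blast

lemma P_subset_L: "P \<subseteq> L"
  using O.prime_subset unfolding int_closure_def by blast

lemma comaximal:
  assumes x: "x \<in> int_closure A L - P"
  shows "\<exists>y\<in>int_closure A L. x * y - 1 \<in> P"
proof -
  have "\<exists>y\<in>int_closure A L. x * y - 1 \<in> P"
    if "lead_coeff g = 1" "\<And>i. coeff g i \<in> A" "poly g x \<in> P" for g
    using that
  proof (induction g)
    case 0
    then show ?case by simp
  next
    case (pCons a h)
    have a: "a \<in> A"
      using pCons.prems(2)[of 0] by simp
    have h: "coeff h i \<in> A" for i
      using pCons.prems(2)[of "Suc i"] by simp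
    have "poly h x \<in> int_closure A L"
      using h subset_int_closure x by (intro O.poly_mem) auto
    have val: "a + x * poly h x \<in> P"
      using pCons.prems(3) by simp
    show ?case
    proof (cases "h = 0")
      case True
      then have "1 \<in> P"
        using pCons.prems by simp
      then show ?thesis
        using O.one_not_prime by blast
    next
      case False
      then have lead: "lead_coeff h = 1"
        using pCons.prems(1) by simp
      show ?thesis
      proof (cases "a \<in> p")
        case True
        then have "x * poly h x \<in> P"
          using O.prime_diff[OF val, of a] p_subset_P by auto
        then have "poly h x \<in> P"
          using O.prime_cases[of x "poly h x"] x \<open>poly h x \<in> int_closure A L\<close> by blast
        then show ?thesis
          using pCons.IH[OF lead h] by blast
      next
        case False
        then obtain a' where a': "a' \<in> A" "a * a' - 1 \<in> p"
          using inverse_mod_prime[of a] a by blast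
        \<comment> \<open>Since \<open>a + x * poly h x\<close> lies in \<open>P\<close>, the
          product \<open>x * y\<close> is congruent to \<open>a * a'\<close>, hence to 1.\<close>
        define y where "y = - (a' * poly h x)"
        have "a' \<in> int_closure A L"
          using a' subset_int_closure by blast
        then have "y \<in> int_closure A L"
          unfolding y_def using \<open>poly h x \<in> int_closure A L\<close>
          by (intro O.uminus_mem O.mult_mem)
        moreover have "x * y - 1 = (a * a' - 1) - a' * (a + x * poly h x)"
          by (simp add: y_def algebra_simps)
        then have "x * y - 1 \<in> P"
          using a' p_subset_P O.prime_smult[OF \<open>a' \<in> int_closure A L\<close> val] O.prime_diff
          by (metis subsetD)
        ultimately show ?thesis
          by blast
      qed
    qed
  qed
  then show ?thesis
    using x O.prime_zero unfolding int_closure_def integral_over_def by force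
qed

text \<open>Both the Horner sums \<open>b i\<close> and the products \<open>z * b (Suc i)\<close>
  are integral, and they differ by \<open>c i\<close>. If \<open>c i\<close> is outside
  \<open>P\<close>, then one of the two is outside \<open>P\<close> and can serve as denominator for
  \<open>z\<close> or for its inverse.\<close>

lemma valuation_ring:
  assumes z: "z \<in> L"
  shows "z \<in> O.loc \<or> inverse z \<in> O.loc"
proof -
  obtain c i where c: "\<And>i. i \<le> n \<Longrightarrow> c i \<in> A" "(\<Sum>i\<le>n. c i * z ^ i) = 0" and i: "i \<le> n" "c i \<notin> p"
    using primitive_relation[OF z] by metis
  have n: "n > 0"
    using c(2) i prime_zero by (cases n) auto
  define b where "b i = (\<Sum>l=i..n. c l * z ^ (l - i))" for i
  have b: "b i \<in> int_closure A L" if "i \<le> Suc n" for i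
    unfolding b_def using integral_horner_sum[OF c z n that] .
  have b_step: "b i = c i + z * b (Suc i)" if "i \<le> n" for i
  proof -
    have "(\<Sum>l=Suc i..n. c l * z ^ (l - i)) = z * b (Suc i)"
      unfolding b_def sum_distrib_left
      by (intro sum.cong) (auto simp: Suc_diff_le[symmetric] power_Suc[symmetric] mult.left_commute
          simp del: power_Suc)
    then show ?thesis
      unfolding b_def[of i] using that by (simp add: sum.atLeast_Suc_atMost)
  qed
  have c_O: "c i \<in> int_closure A L" if "i \<le> n" for i
    using c(1)[OF that] subset_int_closure by blast
  have zb: "z * b (Suc i) \<in> int_closure A L" if "i \<le> n" for i
    using O.diff_mem[OF b c_O, of i i] b_step[OF that] that by simp
  have b0: "b 0 = 0"
    using c(2) by (simp add: b_def atMost_atLeast0)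
  have "c i \<notin> P"
    using i c(1) P_over_p by blast
  then consider "b i \<notin> P" | "z * b (Suc i) \<notin> P"
    using O.prime_diff[of "b i" "z * b (Suc i)"] b_step[OF i(1)] by force
  then show ?thesis
  proof cases
    case 1
    \<comment> \<open>\<open>b 0\<close> is the relation itself and vanishes, so \<open>i\<close> is
      positive and \<open>zb\<close> at its predecessor shows that \<open>z * b i\<close> is
      integral.\<close>
    then obtain j where j: "i = Suc j"
      using b0 O.prime_zero by (cases i) auto
    have "b i \<in> int_closure A L - P"
      using 1 b i by simp
    then have "z * b i / b i \<in> O.loc"
      using zb[of j] i j by (intro O.locI) auto
    moreover have "b i \<noteq> 0"
      using 1 O.prime_zero by auto
    ultimately show ?thesis
      by simp
  next
    case 2
    then have "b (Suc i) / (z * b (Suc i)) \<in> O.loc"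
      using zb[of i] b[of "Suc i"] i by (intro O.locI) auto
    moreover have "b (Suc i) \<noteq> 0"
      using 2 O.prime_zero by auto
    then have "b (Suc i) / (z * b (Suc i)) = inverse z"
      by (simp add: field_simps)
    ultimately show ?thesis
      by simp
  qed
qed

lemma sum_multiples:
  assumes "\<And>i. i \<in> I \<Longrightarrow> \<exists>w\<in>O.loc. f i = x * w"
  shows "\<exists>w\<in>O.loc. sum f I = x * w"
proof -
  obtain w where w: "\<And>i. i \<in> I \<Longrightarrow> w i \<in> O.loc" "\<And>i. i \<in> I \<Longrightarrow> f i = x * w i"
    using assms by metis
  then have "sum f I = x * sum w I"
    by (simp add: sum_distrib_left)
  then show ?thesis
    using V.sum_mem[of I w] w(1) by blast
qed

text \<open>All terms but the \<open>i\<close>-th are divisible by \<open>z ^ Suc i\<close> in the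
  local ring, the higher ones by degree and the lower ones by \<open>low\<close>. Cancelling
  \<open>z ^ i\<close> leaves \<open>c i\<close> as a multiple of \<open>z\<close>.\<close>

lemma lowest_term_multiple:
  assumes c: "\<And>i. i \<le> n \<Longrightarrow> c i \<in> A" "(\<Sum>i\<le>n. c i * z ^ i) = 0" and i: "i \<le> n"
    and low: "\<And>j. j < i \<Longrightarrow> \<exists>w\<in>O.loc. c j * z ^ j = z ^ Suc i * w"
    and z: "z \<in> O.loc" "z \<noteq> 0"
  shows "\<exists>w\<in>O.loc. c i = z * w"
proof -
  have "\<exists>w\<in>O.loc. (\<Sum>j\<in>{..n} - {i}. c j * z ^ j) = z ^ Suc i * w"
  proof (rule sum_multiples)
    fix j assume j: "j \<in> {..n} - {i}"
    show "\<exists>w\<in>O.loc. c j * z ^ j = z ^ Suc i * w"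
    proof (cases "j < i")
      case True
      then show ?thesis by (rule low)
    next
      case False
      then have "z ^ j = z ^ Suc i * z ^ (j - Suc i)"
        using j by (simp add: power_add[symmetric] del: power_Suc)
      then have "c j * z ^ j = z ^ Suc i * (c j * z ^ (j - Suc i))"
        by (simp add: mult_ac)
      moreover have "c j * z ^ (j - Suc i) \<in> O.loc"
        using j c(1) A_subset_V z(1) by (intro V.mult_mem V.power_mem) auto
      ultimately show ?thesis
        by blast
    qed
  qed
  then obtain w where w: "w \<in> O.loc" "(\<Sum>j\<in>{..n} - {i}. c j * z ^ j) = z ^ Suc i * w"
    by blast
  have "c i * z ^ i + (\<Sum>j\<in>{..n} - {i}. c j * z ^ j) = 0"
    using c(2) i by (simp add: sum.remove)
  then have "z ^ i * (c i + z * w) = 0"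
    unfolding w(2) by (simp add: algebra_simps)
  then have "c i = z * (- w)"
    using z(2) by (simp add: eq_neg_iff_add_eq_0)
  then show ?thesis
    using w(1) V.uminus_mem by blast
qed

text \<open>If \<open>e > n\<close>, every coefficient in \<open>p\<close> is divisible by
  \<open>\<pi>\<close> and hence by \<open>t ^ Suc i\<close>, so the first coefficient outside
  \<open>p\<close> would be a multiple of \<open>t\<close> and lie in the maximal ideal. This is the
  form taken here by the bound of the ramification index by the degree.\<close>

lemma power_bound:
  assumes t: "t \<in> P" "t \<noteq> 0" and v: "v \<in> O.loc" "\<pi> = t ^ e * v"
  shows "e \<le> n"
proof (rule ccontr)
  assume e: "\<not> e \<le> n"
  obtain c where c: "\<And>i. i \<le> n \<Longrightarrow> c i \<in> A" "(\<Sum>i\<le>n. c i * t ^ i) = 0" "\<exists>i. i \<le> n \<and> c i \<notin> p"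
    using primitive_relation[of t] t P_subset_L by blast
  define i where "i = (LEAST i. i \<le> n \<and> c i \<notin> p)"
  have i: "i \<le> n" "c i \<notin> p"
    using LeastI_ex[OF c(3)] unfolding i_def by auto
  have tV: "t \<in> O.loc"
    using t O.prime_subset O.subset_loc by blast
  have "\<exists>w\<in>O.loc. c j * t ^ j = t ^ Suc i * w" if j: "j < i" for j
  proof -
    have cj: "c j \<in> p"
      using not_less_Least[OF j[unfolded i_def]] j i by auto
    \<comment> \<open>Here \<open>u * c j\<close> lies in \<open>A\<close> and
      \<open>u * \<pi>\<close> is a unit at \<open>P\<close>, so \<open>c j\<close> is a multiple of
      \<open>\<pi>\<close> in the local ring.\<close>
    have "c j = \<pi> * ((u * c j) * inverse (u * \<pi>))"
      using u_nonzero pi_nonzero by (simp add: field_simps)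
    also have "\<dots> = t ^ Suc i * (t ^ (e - Suc i) * v * (u * c j * inverse (u * \<pi>)))"
    proof -
      have "t ^ e = t ^ Suc i * t ^ (e - Suc i)"
        using e i by (simp add: power_add[symmetric] del: power_Suc)
      then show ?thesis
        unfolding v(2) by (simp add: mult_ac)
    qed
    finally have "c j * t ^ j =
      t ^ Suc i * (t ^ (e - Suc i) * v * (u * c j * inverse (u * \<pi>)) * t ^ j)"
      by (metis mult.assoc)
    moreover have "t ^ (e - Suc i) * v * (u * c j * inverse (u * \<pi>)) * t ^ j \<in> O.loc"
    proof -
      have "u * c j \<in> O.loc" "inverse (u * \<pi>) \<in> O.loc"
        using u_mult[OF cj] A_subset_V O.inverse_loc[OF compl_p_subset[OF u_pi_compl]] by blast+
      then have "u * c j * inverse (u * \<pi>) \<in> O.loc"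
        by (rule V.mult_mem)
      then show ?thesis
        using V.power_mem[OF tV] v(1) V.mult_mem by blast
    qed
    ultimately show ?thesis
      by blast
  qed
  then obtain w where "w \<in> O.loc" "c i = t * w"
    using lowest_term_multiple[OF c(1,2) i(1) _ tV t(2)] by blast
  then have "c i \<in> O.loc_max"
    using O.loc_max_mult[of t w] t O.prime_subset_loc_max by auto
  then show False
    using loc_max_Int_A c(1) i by blast
qed

text \<open>An element \<open>t\<close> of \<open>P\<close> for which the power \<open>t ^ e\<close> dividing \<open>\<pi>\<close> has
  the largest exponent is a uniformizer: otherwise \<open>t\<close> would be divisible by the square
  of an element of \<open>P\<close>, which doubles the exponent.\<close>

lemma ex_local_generator:
  "\<exists>t e v. t \<in> P \<and> t \<noteq> 0 \<and> (\<forall>x\<in>O.loc_max. \<exists>w\<in>O.loc. x = t * w) \<and>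
     \<pi> = t ^ e * v \<and> v \<in> O.loc \<and> inverse v \<in> O.loc"
proof -
  define E where "E e \<longleftrightarrow> (\<exists>t\<in>P. t \<noteq> 0 \<and> (\<exists>v\<in>O.loc. \<pi> = t ^ e * v))" for e
  have "E 1"
    unfolding E_def using pi_mem p_subset_P pi_nonzero V.one_mem
    by (intro bexI[of _ \<pi>] conjI bexI[of _ 1]) auto
  have bound: "e \<le> n" if "E e" for e
    using power_bound that unfolding E_def by blast
  define e where "e = (GREATEST e. E e)"
  have "E e"
    unfolding e_def using \<open>E 1\<close> bound by (rule GreatestI_nat)
  have max: "e' \<le> e" if "E e'" for e'
    unfolding e_def using that bound by (rule Greatest_le_nat)
  have e1: "e \<ge> 1"
    using max[OF \<open>E 1\<close>] .
  obtain t v where t: "t \<in> P" "t \<noteq> 0" and v: "v \<in> O.loc" "\<pi> = t ^ e * v"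
    using \<open>E e\<close> unfolding E_def by blast
  have no_square: False if "s \<in> P" "w \<in> O.loc" "t = s ^ 2 * w" for s w
  proof -
    have "\<pi> = s ^ (2 * e) * (w ^ e * v)"
      unfolding v(2) that(3) by (simp add: power_mult_distrib power_mult mult.assoc)
    moreover have "w ^ e * v \<in> O.loc"
      using that v by (intro V.mult_mem V.power_mem) auto
    moreover have "s \<noteq> 0"
      using that(3) t(2) by auto
    ultimately have "E (2 * e)"
      unfolding E_def using that(1) by blast
    then show False
      using max[of "2 * e"] e1 by simp
  qed
  have gen_P: "\<exists>w\<in>O.loc. x = t * w" if x: "x \<in> P" for x
  proof (cases "x = 0")
    case True
    then show ?thesis using V.zero_mem by force
  next
    case False
    show ?thesis
    proof (cases "x * inverse t \<in> O.loc")
      case True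
      then show ?thesis
        using t(2) by (intro bexI[of _ "x * inverse t"]) auto
    next
      case notin: False
      have "inverse (x * inverse t) \<in> O.loc"
        using valuation_ring[of "x * inverse t"] notin x t(1) P_subset_L inverse_L L.mult_mem by blast
      then have "inverse (x * inverse t) \<in> O.loc_max"
        using O.loc_cases[of "inverse (x * inverse t)"] notin by auto
      then obtain a b where ab: "inverse (x * inverse t) = a / b" "a \<in> P" "b \<in> int_closure A L - P"
        unfolding O.loc_max_def by blast
      \<comment> \<open>As \<open>t\<close> does not divide \<open>x\<close>, the quotient
        \<open>t / x\<close> lies in the maximal ideal, and \<open>t\<close> is up to a unit a
        product of two elements of \<open>P\<close>. One of these divides the other, so
        \<open>t\<close> is divisible by a square.\<close>
      have t_eq: "t = x * a * inverse b"
        using ab(1) False t(2) O.compl_nonzero[OF ab(3)] by (simp add: field_simps)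
      have b: "inverse b \<in> O.loc"
        using O.inverse_loc[OF ab(3)] .
      have "a \<noteq> 0"
        using t_eq t(2) by auto
      have "x * inverse a \<in> L"
        using x ab(2) P_subset_L inverse_L L.mult_mem by blast
      then have "x * inverse a \<in> O.loc \<or> inverse (x * inverse a) \<in> O.loc"
        by (rule valuation_ring)
      then have False
      proof
        assume *: "x * inverse a \<in> O.loc"
        have "t = a ^ 2 * (x * inverse a * inverse b)"
          using t_eq \<open>a \<noteq> 0\<close> by (simp add: power2_eq_square)
        then show False
          using no_square[OF ab(2)] V.mult_mem[OF * b] by blast
      next
        assume *: "inverse (x * inverse a) \<in> O.loc"
        have "t = x ^ 2 * (inverse (x * inverse a) * inverse b)"
          using t_eq False by (simp add: power2_eq_square)
        then show False
          using no_square[OF x] V.mult_mem[OF * b] by blast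
      qed
      then show ?thesis ..
    qed
  qed
  have gen: "\<exists>w\<in>O.loc. x = t * w" if "x \<in> O.loc_max" for x
  proof -
    obtain a b where ab: "x = a / b" "a \<in> P" "b \<in> int_closure A L - P"
      using \<open>x \<in> O.loc_max\<close> unfolding O.loc_max_def by blast
    obtain w where "w \<in> O.loc" "a = t * w"
      using gen_P[OF ab(2)] by blast
    then show ?thesis
      using V.mult_mem[OF _ O.inverse_loc[OF ab(3)], of w] ab(1)
      by (intro bexI[of _ "w * inverse b"]) (auto simp: divide_inverse mult_ac)
  qed
  \<comment> \<open>A cofactor in the maximal ideal would supply one more factor \<open>t\<close>,
    against the choice of \<open>e\<close>.\<close>
  have "v \<notin> O.loc_max"
  proof
    assume "v \<in> O.loc_max"
    then obtain w where "w \<in> O.loc" "v = t * w"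
      using gen by blast
    then have "E (Suc e)"
      unfolding E_def using t v(2) by (intro bexI[of _ t] conjI bexI[of _ w]) (auto simp: mult_ac)
    then show False
      using max[of "Suc e"] by simp
  qed
  then have "inverse v \<in> O.loc"
    using O.loc_cases[OF v(1)] by blast
  then show ?thesis
    using t v gen by blast
qed

text \<open>The lowest nonzero coefficient of a relation for \<open>x\<close> is a multiple of
  \<open>x\<close> and equals \<open>t ^ (e * m)\<close> up to a local unit. So the exponents of
  \<open>t\<close> dividing \<open>x\<close> are bounded, and the largest one leaves a unit as
  cofactor.\<close>

lemma ex_discrete_prime: "\<exists>t. discrete_prime (int_closure A L) P t"
proof -
  obtain t e v where t: "t \<in> P" "t \<noteq> 0" and gen: "\<And>x. x \<in> O.loc_max \<Longrightarrow> \<exists>w\<in>O.loc. x = t * w"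
    and v: "\<pi> = t ^ e * v" "v \<in> O.loc" "inverse v \<in> O.loc"
    using ex_local_generator by blast
  have tV: "t \<in> O.loc"
    using t O.prime_subset O.subset_loc by blast
  have vnz: "v \<noteq> 0"
    using v(1) pi_nonzero by auto
  have "\<exists>k. \<exists>b\<in>int_closure A L - P. \<exists>c\<in>int_closure A L - P. b * x = t ^ k * c"
    if x: "x \<in> int_closure A L" "x \<noteq> 0" for x
  proof -
    define S where "S k \<longleftrightarrow> (\<exists>w\<in>O.loc. x = t ^ k * w)" for k
    have xV: "x \<in> O.loc" and xL: "x \<in> L"
      using x O.subset_loc unfolding int_closure_def by auto
    have "S 0"
      unfolding S_def using xV by auto
    obtain c where c: "\<And>i. i \<le> n \<Longrightarrow> c i \<in> A" "(\<Sum>i\<le>n. c i * x ^ i) = 0" "\<exists>i. i \<le> n \<and> c i \<noteq> 0"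
      using algebraic[OF xL] by blast
    define i where "i = (LEAST i. i \<le> n \<and> c i \<noteq> 0)"
    have i: "i \<le> n" "c i \<noteq> 0"
      using LeastI_ex[OF c(3)] unfolding i_def by auto
    have "\<exists>w\<in>O.loc. c j * x ^ j = x ^ Suc i * w" if j: "j < i" for j
    proof -
      have "c j = 0"
        using not_less_Least[OF j[unfolded i_def]] j i by auto
      then show ?thesis
        using V.zero_mem by (intro bexI[of _ 0]) auto
    qed
    then obtain w where w: "w \<in> O.loc" "c i = x * w"
      using lowest_term_multiple[OF c(1,2) i(1) _ xV x(2)] by blast
    obtain m where m: "u ^ m * c i \<in> A - p"
      using uniformizer_decomposition c(1) i by blast
    have bound: "k \<le> e * m" if "S k" for k
    proof (rule ccontr)
      assume k: "\<not> k \<le> e * m"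
      obtain w' where w': "w' \<in> O.loc" "x = t ^ k * w'"
        using \<open>S k\<close> unfolding S_def by blast
      \<comment> \<open>Up to the units \<open>r\<close> and \<open>(u * \<pi>) ^ m\<close>, the
        coefficient \<open>c i\<close> is \<open>\<pi> ^ m\<close>, hence
        \<open>t ^ (e * m)\<close>. An exponent \<open>k\<close> above \<open>e * m\<close> would
        make \<open>t\<close> invertible in the local ring.\<close>
      define r where "r = u ^ m * c i"
      have r: "r \<noteq> 0" "inverse r \<in> O.loc"
        using m prime_zero O.inverse_loc[OF compl_p_subset[OF m]] unfolding r_def by fastforce+
      have "(u * \<pi>) ^ m * c i = r * \<pi> ^ m"
        unfolding r_def by (simp add: power_mult_distrib)
      then have "(u * \<pi>) ^ m * (t ^ k * w' * w) = r * (t ^ (e * m) * v ^ m)"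
        unfolding w(2) w'(2) v(1) by (simp add: power_mult_distrib power_mult)
      moreover have "t ^ k = t ^ (e * m) * (t * t ^ (k - Suc (e * m)))"
        using k by (simp add: power_add[symmetric] power_Suc[symmetric] del: power_Suc)
      ultimately have "t ^ (e * m) * (t * (t ^ (k - Suc (e * m)) * (u * \<pi>) ^ m * w' * w)) =
          t ^ (e * m) * (r * v ^ m)"
        by (simp add: mult_ac)
      then have "t * (t ^ (k - Suc (e * m)) * (u * \<pi>) ^ m * w' * w) = r * v ^ m"
        using t(2) by simp
      moreover have "r * v ^ m * (inverse r * inverse v ^ m) = 1"
        using r(1) vnz by (simp add: power_inverse field_simps)
      ultimately have
        "t * ((t ^ (k - Suc (e * m)) * (u * \<pi>) ^ m * w' * w) * (inverse r * inverse v ^ m)) = 1"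
        by (metis mult.assoc)
      moreover have "(t ^ (k - Suc (e * m)) * (u * \<pi>) ^ m * w' * w) * (inverse r * inverse v ^ m) \<in> O.loc"
      proof -
        have "u * \<pi> \<in> O.loc"
          using u_pi_compl A_subset_V by blast
        from V.power_mem[OF this] show ?thesis
          by (intro V.mult_mem V.power_mem[OF tV] V.power_mem[OF v(3)] w(1) w'(1) r(2))
      qed
      ultimately have "1 \<in> O.loc_max"
        using O.loc_max_mult[of t] t(1) O.prime_subset_loc_max by (metis subsetD)
      then show False
        using loc_max_Int_A one_mem one_not_prime by blast
    qed
    define k where "k = (GREATEST k. S k)"
    have "S k"
      unfolding k_def using \<open>S 0\<close> bound by (rule GreatestI_nat)
    have max: "k' \<le> k" if "S k'" for k'
      unfolding k_def using that bound by (rule Greatest_le_nat)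
    obtain y where y: "y \<in> O.loc" "x = t ^ k * y"
      using \<open>S k\<close> unfolding S_def by blast
    have "y \<notin> O.loc_max"
    proof
      assume "y \<in> O.loc_max"
      then obtain y' where "y' \<in> O.loc" "y = t * y'"
        using gen by blast
      then have "S (Suc k)"
        unfolding S_def using y(2) by (intro bexI[of _ y']) (auto simp: mult_ac)
      then show False
        using max[of "Suc k"] by simp
    qed
    moreover obtain a b where ab: "y = a / b" "a \<in> int_closure A L" "b \<in> int_closure A L - P"
      using y(1) unfolding O.loc_def by blast
    ultimately have "a \<in> int_closure A L - P"
      using O.loc_maxI by blast
    moreover have "b * x = t ^ k * a"
      unfolding y(2) ab(1) using O.compl_nonzero[OF ab(3)] by simp
    ultimately show ?thesis
      using ab(3) by blast
  qed
  then have "discrete_prime (int_closure A L) P t"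
    using t comaximal by unfold_locales auto
  then show ?thesis ..
qed

text \<open>Elements of the local ring are fractions of integral elements, and each \<open>z\<close>
  in \<open>L\<close> or its inverse is one of them.\<close>

lemma L_subset_frac_field: "L \<subseteq> frac_field (int_closure A L)"
proof
  have loc: "O.loc \<subseteq> frac_field (int_closure A L)"
    unfolding O.loc_def using O.frac_fieldI O.compl_nonzero by auto
  fix z assume "z \<in> L"
  then show "z \<in> frac_field (int_closure A L)"
    using valuation_ring[of z] loc O.inverse_frac_field[of "inverse z"] by auto
qed

text \<open>Each \<open>x\<close> in \<open>p\<close> is \<open>\<pi>\<close> times
  \<open>(u * x) / (u * \<pi>)\<close>, whose denominator is a unit at \<open>P\<close>, so
  \<open>\<pi>\<close> alone decides whether \<open>p\<close> is contained in a power of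
  \<open>P\<close>.\<close>

lemma ram_index_eq: "int (ram_index (int_closure A L) p P) = val_L (int_closure A L) P \<pi>"
  and ram_index_pos: "ram_index (int_closure A L) p P > 0"
proof -
  obtain t where "discrete_prime (int_closure A L) P t"
    using ex_discrete_prime ..
  then interpret D: discrete_prime "int_closure A L" P t .
  have pi_O: "\<pi> \<in> int_closure A L"
    using pi_mem p_subset_P O.prime_subset by blast
  obtain k b c where k: "b \<in> int_closure A L - P" "c \<in> int_closure A L - P" "b * \<pi> = t ^ k * c"
    using D.decomposition[OF pi_O pi_nonzero] by blast
  have "x \<in> ideal_pow (int_closure A L) P k" if x: "x \<in> p" for x
  proof -
    have ux: "u * x \<in> int_closure A L"
      using u_mult[OF x] subset_int_closure by blast
    have "(u * \<pi> * b) * x = (u * x) * (b * \<pi>)"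
      by (simp add: mult_ac)
    then have "(u * \<pi> * b) * x = t ^ k * (c * (u * x))"
      unfolding k(3) by (simp add: mult_ac)
    moreover have "u * \<pi> * b \<in> int_closure A L - P"
      using O.compl_mult[OF compl_p_subset[OF u_pi_compl] k(1)] .
    moreover have "c * (u * x) \<in> int_closure A L"
      using k(2) ux O.mult_mem by blast
    moreover have "x \<in> int_closure A L"
      using x p_subset_P O.prime_subset by blast
    ultimately show ?thesis
      unfolding D.ideal_pow_eq by blast
  qed
  moreover have "ideal_pow (int_closure A L) P k \<subseteq> ideal_pow (int_closure A L) P m" if "m \<le> k" for m
  proof
    fix x assume "x \<in> ideal_pow (int_closure A L) P k"
    then obtain d e where de: "x \<in> int_closure A L" "d \<in> int_closure A L - P" "e \<in> int_closure A L"
      "d * x = t ^ k * e"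
      unfolding D.ideal_pow_eq by blast
    have "t ^ k = t ^ m * t ^ (k - m)"
      using that by (simp add: power_add[symmetric])
    then have "d * x = t ^ m * (t ^ (k - m) * e)"
      unfolding de by (simp add: mult.assoc)
    moreover have "t ^ (k - m) * e \<in> int_closure A L"
      using de D.t_mem_R by (intro O.mult_mem O.power_mem) auto
    ultimately show "x \<in> ideal_pow (int_closure A L) P m"
      unfolding D.ideal_pow_eq using de by blast
  qed
  ultimately have "p \<subseteq> ideal_pow (int_closure A L) P m \<longleftrightarrow> m \<le> k" for m
    using D.mem_ideal_pow_iff[OF pi_O k] pi_mem by blast
  then have ram: "ram_index (int_closure A L) p P = k"
    unfolding ram_index_def by (intro Greatest_equality) auto
  have "\<pi> = t powi int k * (c / b)"
    using k(3) O.compl_nonzero[OF k(1)] by (simp add: field_simps)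
  moreover have "D.local_unit (c / b)"
    unfolding D.local_unit_def using k by blast
  ultimately have "val_L (int_closure A L) P \<pi> = int k"
    using D.val_L_eqI pi_O O.subset_frac_field by blast
  then show "int (ram_index (int_closure A L) p P) = val_L (int_closure A L) P \<pi>"
    using ram by simp
  have "b * \<pi> \<in> P"
    using O.prime_smult[of b \<pi>] k(1) pi_mem p_subset_P by blast
  then have "k \<noteq> 0"
    using k by (cases k) auto
  then show "ram_index (int_closure A L) p P > 0"
    using ram by simp
qed

section \<open>The normalized valuations on the extension field\<close>

lemma val_L_mult:
  "x \<in> L \<Longrightarrow> y \<in> L \<Longrightarrow> x \<noteq> 0 \<Longrightarrow> y \<noteq> 0 \<Longrightarrow>
    val_L (int_closure A L) P (x * y) = val_L (int_closure A L) P x + val_L (int_closure A L) P y"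
  using ex_discrete_prime discrete_prime.val_L_mult L_subset_frac_field by blast

lemma val_L_add:
  "x \<in> L \<Longrightarrow> y \<in> L \<Longrightarrow> x \<noteq> 0 \<Longrightarrow> y \<noteq> 0 \<Longrightarrow> x + y \<noteq> 0 \<Longrightarrow>
    min (val_L (int_closure A L) P x) (val_L (int_closure A L) P y) \<le> val_L (int_closure A L) P (x + y)"
  using ex_discrete_prime discrete_prime.val_L_add L_subset_frac_field by blast

lemma val_L_uminus:
  "x \<in> L \<Longrightarrow> x \<noteq> 0 \<Longrightarrow> val_L (int_closure A L) P (- x) = val_L (int_closure A L) P x"
  using ex_discrete_prime discrete_prime.val_L_uminus L_subset_frac_field by blast

lemma val_L_unit: "a \<in> int_closure A L - P \<Longrightarrow> val_L (int_closure A L) P a = 0"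
  using ex_discrete_prime discrete_prime.val_L_unit by blast

text \<open>In \<open>(u * \<pi>) ^ k * a = (u ^ k * a) * \<pi> ^ k\<close> the factors
  \<open>(u * \<pi>) ^ k\<close> and \<open>u ^ k * a\<close> are units at \<open>P\<close>, so
  \<open>a\<close> has the value of \<open>\<pi> ^ k\<close>.\<close>

lemma val_L_base:
  assumes "a \<in> A" "u ^ k * a \<in> A - p"
  shows "val_L (int_closure A L) P a = int k * int (ram_index (int_closure A L) p P)"
proof -
  let ?v = "val_L (int_closure A L) P"
  have a: "a \<in> L" "a \<noteq> 0"
    using assms A_subset_L prime_zero by auto
  have pi: "\<pi> \<in> L"
    using pi_mem p_subset_P P_subset_L by blast
  have pi_pow: "?v (\<pi> ^ k) = int k * ?v \<pi>" for k
  proof (induction k)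
    case 0
    then show ?case using val_L_unit[OF O.compl_one] by simp
  next
    case (Suc k)
    have "?v (\<pi> * \<pi> ^ k) = ?v \<pi> + ?v (\<pi> ^ k)"
      using pi pi_nonzero by (intro val_L_mult L.power_mem) auto
    then show ?case
      using Suc by (simp add: algebra_simps)
  qed
  have unit: "(u * \<pi>) ^ k \<in> A - p"
    using compl_power[OF u_pi_compl] .
  have unit_L: "(u * \<pi>) ^ k \<in> L" "u ^ k * a \<in> L"
    using unit assms A_subset_L by blast+
  have nz: "(u * \<pi>) ^ k \<noteq> 0" "u ^ k * a \<noteq> 0"
    using unit assms prime_zero by (metis DiffD2)+
  have "?v a = ?v ((u * \<pi>) ^ k * a)"
    using val_L_mult[OF unit_L(1) a(1) nz(1) a(2)] val_L_unit[OF compl_p_subset[OF unit]] by simp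
  also have "(u * \<pi>) ^ k * a = (u ^ k * a) * \<pi> ^ k"
    by (simp add: power_mult_distrib mult_ac)
  also have "?v \<dots> = ?v (\<pi> ^ k)"
    using val_L_mult[OF unit_L(2) L.power_mem[OF pi] nz(2)] val_L_unit[OF compl_p_subset[OF assms(2)]]
      pi_nonzero by simp
  finally show ?thesis
    unfolding pi_pow ram_index_eq .
qed

lemma wP_mult:
  assumes "x \<in> L" "y \<in> L"
  shows "wP (int_closure A L) p P (x * y) = wP (int_closure A L) p P x + wP (int_closure A L) p P y"
  using assms by (cases "x = 0 \<or> y = 0") (auto simp: wP_def val_L_mult add_divide_distrib)

lemma wP_add:
  assumes "x \<in> L" "y \<in> L"
  shows "wP (int_closure A L) p P (x + y) \<ge> min (wP (int_closure A L) p P x) (wP (int_closure A L) p P y)"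
proof (cases "x = 0 \<or> y = 0 \<or> x + y = 0")
  case True
  then show ?thesis by (auto simp: wP_def)
next
  case False
  then have "min (val_L (int_closure A L) P x) (val_L (int_closure A L) P y)
      \<le> val_L (int_closure A L) P (x + y)"
    using val_L_add assms by blast
  then show ?thesis
    using False ram_index_pos by (auto simp: wP_def min_le_iff_disj divide_right_mono)
qed

lemma wP_diff:
  assumes "x \<in> L" "y \<in> L"
  shows "wP (int_closure A L) p P (x - y) \<ge> min (wP (int_closure A L) p P x) (wP (int_closure A L) p P y)"
proof -
  have "wP (int_closure A L) p P (- y) = wP (int_closure A L) p P y"
    using assms by (simp add: wP_def val_L_uminus)
  then show ?thesis
    using wP_add[of x "- y"] assms L.uminus_mem by simp
qed

text \<open>Numerator and denominator have values that are multiples of the ramification index,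
  which cancels; what remains depends on the exponents at \<open>p\<close> alone.\<close>

lemma wP_base:
  assumes "a \<in> A" "b \<in> A" "u ^ k * a \<in> A - p" "u ^ l * b \<in> A - p"
  shows "wP (int_closure A L) p P (a / b) = ereal (of_int (int k - int l))"
proof -
  have nz: "a \<noteq> 0" "b \<noteq> 0"
    using assms prime_zero by auto
  have ab: "a / b \<in> L" "b \<in> L"
    using assms A_subset_L inverse_L L.mult_mem unfolding divide_inverse by blast+
  have "val_L (int_closure A L) P a = val_L (int_closure A L) P (a / b) + val_L (int_closure A L) P b"
    using val_L_mult[OF ab] nz by simp
  then have "val_L (int_closure A L) P (a / b) = (int k - int l) * int (ram_index (int_closure A L) p P)"
    using val_L_base[OF assms(1,3)] val_L_base[OF assms(2,4)] by (simp add: left_diff_distrib)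
  then show ?thesis
    using nz ram_index_pos by (simp add: wP_def)
qed

end

section \<open>Semi-reduced families\<close>

lemma efloor_ereal [simp]: "efloor (ereal x) = ereal (of_int \<lfloor>x\<rfloor>)"
  and efloor_PInfty [simp]: "efloor \<infinity> = \<infinity>"
  by (simp_all add: efloor_def flip: infinity_ereal_def)

lemma efloor_mono: "x \<le> y \<Longrightarrow> efloor x \<le> efloor y"
  by (cases x; cases y) (auto simp: efloor_def intro: floor_mono)

lemma efloor_le_iff: "efloor x \<le> ereal (of_int m) \<longleftrightarrow> x < ereal (of_int (m + 1))"
  by (cases x) (auto simp: efloor_def floor_le_iff simp flip: infinity_ereal_def)

text \<open>A monotone function commutes with binary minima, and the empty infimum is infinity,
  which \<open>efloor\<close> fixes.\<close>

lemma efloor_INF: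
  assumes "finite C"
  shows "efloor (INF c\<in>C. f c) = (INF c\<in>C. efloor (f c))"
  using assms
proof (induction C rule: finite_induct)
  case empty
  then show ?case by (simp add: top_ereal_def)
next
  case (insert a C)
  have "efloor (inf x y) = inf (efloor x) (efloor y)" for x y
    using efloor_mono[of x y] efloor_mono[of y x] by (cases "x \<le> y") (auto simp: inf_absorb1 inf_absorb2)
  then show ?case
    using insert by simp
qed

lemma INF_finite_attained:
  fixes f :: "'b \<Rightarrow> ereal"
  assumes "finite C" "C \<noteq> {}"
  shows "\<exists>c\<in>C. (INF c\<in>C. f c) = f c"
  using Min_in[of "f ` C"] assms by (auto simp: Min_Inf)

text \<open>The combinatorial core, for arbitrary functions \<open>W j\<close> that obey the
  valuation laws. By \<open>W_K\<close> a scalar has one integer value common to all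
  \<open>W j\<close>, which ties the comparisons between different indices to the family
  itself.\<close>

lemma semi_reduced_union:
  fixes W :: "nat \<Rightarrow> 'a::field \<Rightarrow> ereal" and B :: "nat \<Rightarrow> 'a set"
  assumes L: "subring_of L" and K: "K \<subseteq> L"
    and W_zero: "\<And>j. j < s \<Longrightarrow> W j 0 = \<infinity>"
    and W_fin: "\<And>j x. j < s \<Longrightarrow> x \<in> L \<Longrightarrow> x \<noteq> 0 \<Longrightarrow> \<exists>r. W j x = ereal r"
    and W_mult: "\<And>j x y. j < s \<Longrightarrow> x \<in> L \<Longrightarrow> y \<in> L \<Longrightarrow> W j (x * y) = W j x + W j y"
    and W_add: "\<And>j x y. j < s \<Longrightarrow> x \<in> L \<Longrightarrow> y \<in> L \<Longrightarrow> W j (x + y) \<ge> min (W j x) (W j y)"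
    and W_diff: "\<And>j x y. j < s \<Longrightarrow> x \<in> L \<Longrightarrow> y \<in> L \<Longrightarrow> W j (x - y) \<ge> min (W j x) (W j y)"
    and W_K: "\<And>x. x \<in> K \<Longrightarrow> x \<noteq> 0 \<Longrightarrow> \<exists>k::int. \<forall>j<s. W j x = ereal (of_int k)"
    and B: "\<And>i. i < s \<Longrightarrow> finite (B i) \<and> B i \<subseteq> L \<and> 0 \<notin> B i \<and> w_reduced K (W i) (B i)"
    and z: "\<And>i. i < s \<Longrightarrow> z i \<in> L \<and> z i \<noteq> 0"
    and dom: "\<And>i b. i < s \<Longrightarrow> b \<in> B i \<Longrightarrow>
       (\<forall>j. i < j \<and> j < s \<longrightarrow> efloor (W i (z i * b)) \<le> efloor (W j (z i * b)))
       \<and> (\<forall>l<i. efloor (W i (z i * b)) < efloor (W l (z i * b)))"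
  shows "w_semi_reduced K (\<lambda>x. INF j\<in>{..<s}. W j x) (\<Union>i<s. (\<lambda>b. z i * b) ` B i)"
  unfolding w_semi_reduced_def
proof (intro allI impI)
  interpret L: subring L
    using L by unfold_locales
  define C where "C = (\<Union>i<s. (\<lambda>b. z i * b) ` B i)"
  define wS where "wS x = (INF j\<in>{..<s}. W j x)" for x
  fix lam assume "\<forall>c\<in>(\<Union>i<s. (\<lambda>b. z i * b) ` B i). lam c \<in> K"
  then have lam: "lam c \<in> K" if "c \<in> C" for c
    using that unfolding C_def by blast
  define X where "X I = (\<Sum>c\<in>I. lam c * c)" for I
  have finC: "finite C"
    unfolding C_def using B by auto
  have C_L: "c \<in> L" "c \<noteq> 0" if c: "c \<in> C" for c
  proof -
    obtain i b where "i < s" "b \<in> B i" "c = z i * b"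
      using c unfolding C_def by blast
    then show "c \<in> L" "c \<noteq> 0"
      using B[of i] z[of i] L.mult_mem by auto
  qed
  have lam_L: "lam c * c \<in> L" if "c \<in> C" for c
    using lam C_L K that by (intro L.mult_mem) auto
  have X_L: "X I \<in> L" if "I \<subseteq> C" for I
    unfolding X_def using that lam_L by (intro L.sum_mem) auto
  have X_ge: "m \<le> W j (X I)" if j: "j < s" and I: "I \<subseteq> C" "\<And>c. c \<in> I \<Longrightarrow> m \<le> W j (lam c * c)" for m j I
  proof -
    have "finite I"
      using I finC finite_subset by blast
    then show ?thesis
      using I
    proof (induction I rule: finite_induct)
      case empty
      then show ?case using W_zero[OF j] by (simp add: X_def)
    next
      case (insert c I)
      have "m \<le> min (W j (lam c * c)) (W j (X I))"
        using insert by simp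
      also have "\<dots> \<le> W j (lam c * c + X I)"
        using insert.prems lam_L X_L by (intro W_add[OF j]) auto
      finally show ?case
        using insert by (simp add: X_def)
    qed
  qed
  \<comment> \<open>The integer \<open>k\<close> comes out of the floor. Since it is the same for
    all \<open>j\<close>, comparisons of floors at \<open>c\<close> carry over to
    \<open>lam c * c\<close>.\<close>
  have shift: "efloor (W j (lam c * c)) = ereal (of_int k) + efloor (W j c)"
    if "j < s" "c \<in> C" "W j (lam c) = ereal (of_int k)" for j c k
  proof -
    obtain r where r: "W j c = ereal r"
      using W_fin[OF \<open>j < s\<close>] C_L \<open>c \<in> C\<close> by blast
    have "W j (lam c * c) = ereal (of_int k + r)"
      using W_mult[OF that(1)] lam[OF that(2)] C_L(1)[OF that(2)] K that(3) r by auto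
    then show ?thesis
      unfolding r by simp
  qed
  have ge: "efloor (W i (lam c * c)) \<le> efloor (W j (lam c * c))"
    if "i < s" "c \<in> (\<lambda>b. z i * b) ` B i" "j < s" for i c j
  proof -
    have c: "c \<in> C"
      using that unfolding C_def by blast
    have le: "efloor (W i c) \<le> efloor (W j c)"
      using dom[of i] that by (cases i j rule: linorder_cases) (auto intro: less_imp_le)
    show ?thesis
    proof (cases "lam c = 0")
      case True
      then show ?thesis using W_zero that by simp
    next
      case False
      then obtain k where k: "\<forall>j<s. W j (lam c) = ereal (of_int k)"
        using W_K lam[OF c] by blast
      show ?thesis
        using shift[OF that(1) c] shift[OF that(3) c] k that le by (simp add: add_left_mono)
    qed
  qed
  \<comment> \<open>For \<open>lam c = 0\<close> both sides would be infinite, hence the condition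
    on the scalar.\<close>
  have gr: "efloor (W i (lam c * c)) < efloor (W l (lam c * c))"
    if "i < s" "c \<in> (\<lambda>b. z i * b) ` B i" "l < i" "lam c \<noteq> 0" for i c l
  proof -
    have c: "c \<in> C"
      using that unfolding C_def by blast
    obtain k where k: "\<forall>j<s. W j (lam c) = ereal (of_int k)"
      using W_K lam[OF c] \<open>lam c \<noteq> 0\<close> by blast
    have l: "l < s"
      using that by simp
    have "efloor (W i c) < efloor (W l c)"
      using dom[of i] that by auto
    then show ?thesis
      using shift[OF that(1) c] shift[OF l c] k that l by (simp add: ereal_less_add)
  qed
  have wS_floor: "efloor (wS (lam c * c)) = efloor (W i (lam c * c))"
    if "i < s" "c \<in> (\<lambda>b. z i * b) ` B i" for i c
  proof -
    have "efloor (wS (lam c * c)) = (INF j\<in>{..<s}. efloor (W j (lam c * c)))"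
      unfolding wS_def by (rule efloor_INF) simp
    also have "\<dots> = efloor (W i (lam c * c))"
      using that ge[OF that] by (intro antisym INF_lower INF_greatest) auto
    finally show ?thesis .
  qed
  define \<mu> where "\<mu> = (INF c\<in>C. efloor (wS (lam c * c)))"
  have "(INF c\<in>C. wS (lam c * c)) \<le> wS (X C)"
  proof -
    have "(INF c\<in>C. wS (lam c * c)) \<le> W j (X C)" if j: "j < s" for j
    proof (rule X_ge[OF j subset_refl])
      fix c assume "c \<in> C"
      then have "(INF c\<in>C. wS (lam c * c)) \<le> wS (lam c * c)"
        by (rule INF_lower)
      also have "\<dots> \<le> W j (lam c * c)"
        unfolding wS_def using j by (intro INF_lower) auto
      finally show "(INF c\<in>C. wS (lam c * c)) \<le> W j (lam c * c)" .
    qed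
    then show ?thesis
      unfolding wS_def[of "X C"] by (intro INF_greatest) auto
  qed
  then have lower: "\<mu> \<le> efloor (wS (X C))"
    unfolding \<mu>_def efloor_INF[OF finC, symmetric] by (rule efloor_mono)
  have upper: "efloor (wS (X C)) \<le> \<mu>"
  \<comment> \<open>An infinite \<open>\<mu>\<close> is an upper bound for everything; this covers
    the empty family, whose infimum is infinite.\<close>
  proof (cases "\<mu> = \<infinity>")
    case True
    then show ?thesis by simp
  next
    case False
    then have "C \<noteq> {}"
      unfolding \<mu>_def by (auto simp: top_ereal_def)
    then obtain c0 where c0: "c0 \<in> C" "\<mu> = efloor (wS (lam c0 * c0))"
      using INF_finite_attained[OF finC, of "\<lambda>c. efloor (wS (lam c * c))"] unfolding \<mu>_def by blast
    define Q where "Q j \<longleftrightarrow> j < s \<and> (\<exists>c\<in>(\<lambda>b. z j * b) ` B j. efloor (wS (lam c * c)) = \<mu>)" for j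
    have "\<exists>j. Q j"
      using c0 unfolding Q_def C_def by fastforce
    define j where "j = (LEAST j. Q j)"
    have "Q j"
      unfolding j_def using \<open>\<exists>j. Q j\<close> by (rule LeastI_ex)
    then obtain b0 where j: "j < s" and b0: "b0 \<in> B j"
      "efloor (wS (lam (z j * b0) * (z j * b0))) = \<mu>"
      unfolding Q_def by blast
    define c1 where "c1 = z j * b0"
    have c1: "c1 \<in> C" "c1 \<in> (\<lambda>b. z j * b) ` B j"
      using j b0 unfolding C_def c1_def by auto
    have c1_mu: "efloor (W j (lam c1 * c1)) = \<mu>"
      using wS_floor[OF j c1(2)] b0(2) unfolding c1_def by simp
    have "lam c1 * c1 \<noteq> 0"
      using c1_mu False W_zero[OF j] by auto
    then obtain r where r: "W j (lam c1 * c1) = ereal r"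
      using W_fin[OF j lam_L[OF c1(1)]] by blast
    define m where "m = \<lfloor>r\<rfloor>"
    have mu: "\<mu> = ereal (of_int m)"
      using c1_mu r by (simp add: m_def)
    define D where "D = (\<lambda>b. z j * b) ` B j"
    have D_C: "D \<subseteq> C"
      unfolding D_def C_def using j by blast
    have "ereal (of_int (m + 1)) \<le> W j (X (C - D))"
    proof (rule X_ge[OF j])
      fix c assume c: "c \<in> C - D"
      then obtain i where i: "i < s" "c \<in> (\<lambda>b. z i * b) ` B i"
        unfolding C_def by blast
      have mu_le: "\<mu> \<le> efloor (W i (lam c * c))"
        unfolding wS_floor[OF i, symmetric] \<mu>_def using c by (intro INF_lower) auto
      have "\<mu> < efloor (W j (lam c * c))"
      proof (cases "lam c = 0")
        case True
        then show ?thesis using W_zero[OF j] mu by simp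
      next
        case nz: False
        have "i \<noteq> j"
          using c i unfolding D_def by auto
        then consider "i < j" | "j < i"
          by linarith
        then show ?thesis
        proof cases
          case 1
          have "\<not> Q i"
            using 1 not_less_Least unfolding j_def by blast
          then have "\<mu> \<noteq> efloor (W i (lam c * c))"
            using i wS_floor[OF i] unfolding Q_def by metis
          then show ?thesis
            using mu_le ge[OF i j] by simp
        next
          case 2
          then show ?thesis
            using mu_le gr[OF i 2 nz] by simp
        qed
      qed
      \<comment> \<open>A floor strictly above the integer \<open>m\<close> forces the value itself
        to be at least \<open>m + 1\<close>.\<close>
      then show "ereal (of_int (m + 1)) \<le> W j (lam c * c)"
        unfolding mu using efloor_le_iff[of "W j (lam c * c)" m] by (meson not_le)
    qed auto
    moreover have "W j (X D) \<le> W j (lam c1 * c1)"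
    proof -
      define \<nu> where "\<nu> b = lam (z j * b)" for b
      have \<nu>_K: "\<nu> b \<in> K" if "b \<in> B j" for b
        unfolding \<nu>_def using lam D_C that by (auto simp: D_def)
      have zj: "z j \<in> L" "z j \<noteq> 0"
        using z[OF j] by auto
      have \<nu>_L: "\<nu> b * b \<in> L" if "b \<in> B j" for b
        using \<nu>_K[OF that] K B[OF j] that by (intro L.mult_mem) auto
      have sum_L: "(\<Sum>b\<in>B j. \<nu> b * b) \<in> L"
        using \<nu>_L by (rule L.sum_mem)
      \<comment> \<open>Reducedness is assumed for \<open>B j\<close> and not for its multiple, so
        \<open>z j\<close> is factored out; multiplication by \<open>z j\<close> is injective, which
        turns the sum over \<open>D\<close> into a sum over \<open>B j\<close>.\<close>
      have "X D = (\<Sum>b\<in>B j. lam (z j * b) * (z j * b))"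
        unfolding X_def D_def using zj by (subst sum.reindex) (auto simp: inj_on_def)
      also have "\<dots> = z j * (\<Sum>b\<in>B j. \<nu> b * b)"
        by (simp add: \<nu>_def sum_distrib_left mult_ac)
      finally have "W j (X D) = W j (z j) + W j (\<Sum>b\<in>B j. \<nu> b * b)"
        using W_mult[OF j zj(1) sum_L] by simp
      also have "W j (\<Sum>b\<in>B j. \<nu> b * b) = (INF b\<in>B j. W j (\<nu> b * b))"
        using B[OF j] \<nu>_K unfolding w_reduced_def by blast
      also have "W j (z j) + \<dots> \<le> W j (z j) + W j (\<nu> b0 * b0)"
        using b0 by (intro add_left_mono INF_lower)
      also have "\<dots> = W j (z j * (\<nu> b0 * b0))"
        using W_mult[OF j zj(1) \<nu>_L[OF b0(1)]] by simp
      also have "z j * (\<nu> b0 * b0) = lam c1 * c1"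
        by (simp add: \<nu>_def c1_def mult_ac)
      finally show ?thesis .
    qed
    then have "W j (X D) < ereal (of_int (m + 1))"
      using r unfolding m_def by (metis efloor_ereal efloor_le_iff order_refl order_le_less_trans)
    \<comment> \<open>If the whole sum had value at least \<open>m + 1\<close> at index
      \<open>j\<close>, then so would \<open>X D\<close>, after subtracting the outside
      terms.\<close>
    moreover have "X D = X C - X (C - D)"
      unfolding X_def using D_C finC by (simp add: sum_diff)
    then have "min (W j (X C)) (W j (X (C - D))) \<le> W j (X D)"
      using W_diff[OF j X_L[OF subset_refl] X_L[of "C - D"]] by simp
    ultimately have "W j (X C) < ereal (of_int (m + 1))"
      by (metis le_less_trans min_def not_le order.trans)
    then have "efloor (W j (X C)) \<le> \<mu>"
      unfolding mu efloor_le_iff .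
    moreover have "wS (X C) \<le> W j (X C)"
      unfolding wS_def using j by (intro INF_lower) auto
    ultimately show ?thesis
      using efloor_mono order.trans by blast
  qed
  show "efloor (INF j\<in>{..<s}. W j (\<Sum>c\<in>(\<Union>i<s. (\<lambda>b. z i * b) ` B i). lam c * c)) =
      (INF c\<in>(\<Union>i<s. (\<lambda>b. z i * b) ` B i). efloor (INF j\<in>{..<s}. W j (lam c * c)))"
    using antisym[OF upper lower] unfolding \<mu>_def X_def wS_def C_def .
qed

section \<open>Specialization to the primes above \<open>p\<close>\<close>

theorem mainTheorem9:
  fixes A p :: "'a::field set" and f :: "'a poly" and \<theta> :: 'a
    and Ps :: "'a set list" and B :: "nat \<Rightarrow> 'a set" and z :: "nat \<Rightarrow> 'a"
  defines "K \<equiv> frac_field A"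
  defines "L \<equiv> simple_ext K \<theta>"
  defines "Ocl \<equiv> int_closure A L"
  defines "s \<equiv> length Ps"
  assumes "dedekind_domain A"
    and "prime_ideal_of A p" and "p \<noteq> {0}"
    and "lead_coeff f = 1" and "\<forall>i. coeff f i \<in> A"
    and "irreducible_over K f" and "separable_over K f"
    and "poly f \<theta> = 0"
    and "distinct Ps" and "set Ps = primes_over Ocl A p"
    and "\<forall>i<s. finite (B i) \<and> B i \<subseteq> L \<and> 0 \<notin> B i \<and> w_reduced K (wP Ocl p (Ps ! i)) (B i)"
    and "\<forall>i<s. z i \<in> L \<and> z i \<noteq> 0"
    and "\<forall>i<s. \<forall>b\<in>B i.
           (\<forall>j. i < j \<and> j < s \<longrightarrow>
              efloor (wP Ocl p (Ps ! i) (z i * b)) \<le> efloor (wP Ocl p (Ps ! j) (z i * b)))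
         \<and> (\<forall>l<i. efloor (wP Ocl p (Ps ! i) (z i * b)) < efloor (wP Ocl p (Ps ! l) (z i * b)))"
  shows "w_semi_reduced K (wS Ocl p Ps) (\<Union>i<s. (\<lambda>b. z i * b) ` B i)"
proof -
  interpret dedekind_prime A p
    using assms(5-7) by unfold_locales (auto simp: dedekind_domain_def)
  obtain u \<pi> where u: "u \<in> frac_field A" "u \<notin> A" "\<And>x. x \<in> p \<Longrightarrow> u * x \<in> A"
    "\<pi> \<in> p" "u * \<pi> \<notin> p"
    using ex_uniformizer by blast
  interpret uniformized_prime A p u \<pi>
    using u by unfold_locales
  interpret K: subring K
    unfolding K_def using subring_frac_field by unfold_locales
  have K_inv: "inverse x \<in> K" if "x \<in> K" for x
    using that inverse_frac_field unfolding K_def by blast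
  have A_K: "A \<subseteq> K"
    unfolding K_def by (rule subset_frac_field)
  have K_L: "K \<subseteq> L"
    unfolding L_def by (rule K.subset_simple_ext)
  \<comment> \<open>The relation has coefficients in \<open>K\<close> at first; a common denominator
    moves them into \<open>A\<close> and keeps the degree bound.\<close>
  have algebraic: "\<exists>c. (\<forall>i\<le>degree f. c i \<in> A) \<and> (\<exists>i\<le>degree f. c i \<noteq> 0) \<and>
      (\<Sum>i\<le>degree f. c i * x ^ i) = 0" if "x \<in> L" for x
  proof -
    have "\<exists>c. (\<forall>i. c i \<in> K) \<and> (\<exists>i\<le>degree f. c i \<noteq> 0) \<and> (\<Sum>i\<le>degree f. c i * x ^ i) = 0"
    proof (rule K.simple_ext_algebraic[OF assms(8) _ assms(12)])
      show "coeff f i \<in> K" for i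
        using assms(9) A_K by blast
      show "inverse y \<in> K" if "y \<in> K" for y
        using that by (rule K_inv)
      show "x \<in> simple_ext K \<theta>"
        using that unfolding L_def .
    qed
    then obtain c where c: "\<And>i. c i \<in> K" "\<exists>i\<le>degree f. c i \<noteq> 0"
      "(\<Sum>i\<le>degree f. c i * x ^ i) = 0"
      by blast
    obtain d where d: "d \<noteq> 0" "\<forall>i\<in>{..degree f}. d * c i \<in> A"
      using common_denominator[of "{..degree f}" c] c(1) unfolding K_def by auto
    have "(\<Sum>i\<le>degree f. d * c i * x ^ i) = d * (\<Sum>i\<le>degree f. c i * x ^ i)"
      by (simp add: sum_distrib_left mult.assoc)
    then show ?thesis
      using c(2,3) d by (intro exI[of _ "\<lambda>i. d * c i"]) auto
  qed
  interpret dedekind_extension A p u \<pi> L "degree f"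
    using K.subring_simple_ext K.inverse_simple_ext A_K K_L algebraic
    by unfold_locales (auto simp: L_def)
  have above: "prime_above A p u \<pi> L (degree f) (Ps ! j)" if "j < s" for j
  proof -
    have "Ps ! j \<in> primes_over Ocl A p"
      using that assms(14) nth_mem unfolding s_def by blast
    then show ?thesis
      unfolding primes_over_def Ocl_def by unfold_locales auto
  qed
  have "w_semi_reduced K (\<lambda>x. INF j\<in>{..<s}. wP Ocl p (Ps ! j) x) (\<Union>i<s. (\<lambda>b. z i * b) ` B i)"
  proof (rule semi_reduced_union[OF subring_L K_L])
    show "wP Ocl p (Ps ! j) 0 = \<infinity>" for j
      by (simp add: wP_def)
    show "\<exists>r. wP Ocl p (Ps ! j) x = ereal r" if "x \<noteq> 0" for j x
      using that by (simp add: wP_def)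
    show "wP Ocl p (Ps ! j) (x * y) = wP Ocl p (Ps ! j) x + wP Ocl p (Ps ! j) y"
      if "j < s" "x \<in> L" "y \<in> L" for j x y
      using prime_above.wP_mult[OF above] that unfolding Ocl_def by blast
    show "wP Ocl p (Ps ! j) (x + y) \<ge> min (wP Ocl p (Ps ! j) x) (wP Ocl p (Ps ! j) y)"
      if "j < s" "x \<in> L" "y \<in> L" for j x y
      using prime_above.wP_add[OF above] that unfolding Ocl_def by blast
    show "wP Ocl p (Ps ! j) (x - y) \<ge> min (wP Ocl p (Ps ! j) x) (wP Ocl p (Ps ! j) y)"
      if "j < s" "x \<in> L" "y \<in> L" for j x y
      using prime_above.wP_diff[OF above] that unfolding Ocl_def by blast
    show "\<exists>k::int. \<forall>j<s. wP Ocl p (Ps ! j) x = ereal (of_int k)" if x: "x \<in> K" "x \<noteq> 0" for x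
    proof -
      obtain a b where ab: "x = a / b" "a \<in> A" "b \<in> A" "a \<noteq> 0" "b \<noteq> 0"
        using x unfolding K_def frac_field_def by auto
      \<comment> \<open>The exponents come from \<open>a\<close> and \<open>b\<close> alone, so one
        integer serves all primes at once.\<close>
      obtain k l where "u ^ k * a \<in> A - p" "u ^ l * b \<in> A - p"
        using uniformizer_decomposition ab by metis
      then have "\<forall>j<s. wP Ocl p (Ps ! j) x = ereal (of_int (int k - int l))"
        using prime_above.wP_base[OF above] ab unfolding Ocl_def by blast
      then show ?thesis ..
    qed
  qed (use assms(15-17) in auto)
  moreover have "set Ps = (\<lambda>j. Ps ! j) ` {..<s}"
    unfolding s_def by (auto simp: set_conv_nth)
  then have "wS Ocl p Ps = (\<lambda>x. INF j\<in>{..<s}. wP Ocl p (Ps ! j) x)"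
    by (simp add: fun_eq_iff wS_def image_image)
  ultimately show ?thesis
    by simp
qed

end
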